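(* Let $(k_n)_n$ and $(l_n)_n$ be sequences of natural numbers with $\lim_nk_n=\lim_nl_n=\infty$. Let $\varphi:\mathrm{M}^{\mathrm{HS}}_\infty[(k_n)_n]\to\mathrm{M}^{\mathrm{HS}}_\infty[(l_n)_n]$ be a unital ring isomorphism. Then there exists a unique automorphism (self-homeomorphism) $\theta$ of $\partial\beta\mathbb N$ such that for all $a,b\in\mathrm{M}^{\mathrm{HS}}_\infty[(k_n)_n]$ and all $S\in\mathscr P(\mathbb N)/\mathrm{Fin}$, $$a=_Sb\iff\varphi(a)=_{\theta(S)}\varphi(b).$$ Consequently, for every nonprincipal ultrafilter $\mathcal U\in\partial\beta\mathbb N$, $\varphi$ induces a ring isomorphism between the metric ultraproduct of the $\mathrm{M}_{k_n}(\mathbb C)$ along $\theta(\mathcal U)$ and the metric ultraproduct of the $\mathrm{M}_{l_n}(\mathbb C)$ along $\mathcal U$.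
   Context: For $k\ge 1$ and $x\in\mathrm{M}_k(\mathbb C)$, $\|x\|_{2,k}=(\frac1k\mathrm{tr}(x^*x))^{1/2}$. For a sequence $(k_n)_n$ of positive integers with $k_n\to\infty$, $\mathrm{M}^{\mathrm{HS}}_\infty[(k_n)_n]$ is the unital $*$-algebra of operator-norm bounded sequences $(a_n)_n\in\prod_n\mathrm{M}_{k_n}(\mathbb C)$ with coordinatewise operations, modulo the ideal of sequences with $\|a_n\|_{2,k_n}\to0$; $[a_n]_n$ denotes the class of $(a_n)_n$. For $a=[a_n]_n,b=[b_n]_n$ and $S\subseteq\mathbb N$, $a=_Sb$ means $\lim_{n\in S}\|a_n-b_n\|_{2,k_n}=0$ (vacuous for finite $S$); it depends only on the class of $S$ in $\mathscr P(\mathbb N)/\mathrm{Fin}$, $\mathrm{Fin}$ being the ideal of finite sets. $\partial\beta\mathbb N=\beta\mathbb N\setminus\mathbb N$ is the space of nonprincipal ultrafilters on $\mathbb N$. By Stone duality a self-homeomorphism $\theta$ of $\partial\beta\mathbb N$ corresponds to a Boolean algebra automorphism of $\mathscr P(\mathbb N)/\mathrm{Fin}$, denoted by the same symbol, via $\theta(\mathcal U)=\{S:\theta(S)\in\mathcal U\}$. The metric ultraproduct along $\mathcal U$ is the ring of operator-norm bounded sequences modulo those with $\lim_{n\to\mathcal U}\|a_n\|_{2,k_n}=0$; it is a quotient of $\mathrm{M}^{\mathrm{HS}}_\infty[(k_n)_n]$, and "induces" means that the class of $a$ is sent to the class of $\varphi(a)$. *)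

theory Defs
  imports
    "HOL-Algebra.QuotRing"
    "HOL-Analysis.Abstract_Topology"
    "HOL-Library.FuncSet"
    "Jordan_Normal_Form.Schur_Decomposition"
begin

definition vec_norm2 :: "complex vec \<Rightarrow> real" where
  "vec_norm2 v = sqrt (Re (v \<bullet>c v))"

definition op_norm :: "complex mat \<Rightarrow> real" where
  "op_norm A = (SUP v \<in> {v \<in> carrier_vec (dim_col A). vec_norm2 v \<le> 1}. vec_norm2 (A *\<^sub>v v))"

definition mat_trace :: "complex mat \<Rightarrow> complex" where
  "mat_trace A = (\<Sum>i<dim_row A. A $$ (i, i))"

text \<open>The normalised Hilbert--Schmidt norm; it is applied to square matrices only, so the size
  \<open>k\<close> can be read off the matrix.\<close>

definition hs_norm :: "complex mat \<Rightarrow> real" where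
  "hs_norm A = sqrt (Re (mat_trace (mat_adjoint A * A)) / real (dim_row A))"

definition bounded_seqs :: "(nat \<Rightarrow> nat) \<Rightarrow> (nat \<Rightarrow> complex mat) ring" where
  "bounded_seqs k = \<lparr>
     partial_object.carrier = {a. (\<forall>n. a n \<in> carrier_mat (k n) (k n)) \<and> (\<exists>C. \<forall>n. op_norm (a n) \<le> C)},
     monoid.mult = (\<lambda>a b n. a n * b n),
     monoid.one = (\<lambda>n. 1\<^sub>m (k n)),
     ring.zero = (\<lambda>n. 0\<^sub>m (k n) (k n)),
     ring.add = (\<lambda>a b n. a n + b n)\<rparr>"

text \<open>\<open>F = sequentially\<close> gives the ideal defining
  \<open>MHS k\<close>, an ultrafilter \<open>F\<close> the one defining the metric ultraproduct.\<close>

definition null_seqs :: "(nat \<Rightarrow> nat) \<Rightarrow> nat filter \<Rightarrow> (nat \<Rightarrow> complex mat) set" where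
  "null_seqs k F = {a \<in> carrier (bounded_seqs k). ((\<lambda>n. hs_norm (a n)) \<longlongrightarrow> 0) F}"

definition seq_class ::
    "(nat \<Rightarrow> nat) \<Rightarrow> nat filter \<Rightarrow> (nat \<Rightarrow> complex mat) \<Rightarrow> (nat \<Rightarrow> complex mat) set" where
  "seq_class k F a = null_seqs k F +>\<^bsub>bounded_seqs k\<^esub> a"

definition MHS :: "(nat \<Rightarrow> nat) \<Rightarrow> (nat \<Rightarrow> complex mat) set ring" where
  "MHS k = bounded_seqs k Quot null_seqs k sequentially"

definition metric_ultraproduct ::
    "(nat \<Rightarrow> nat) \<Rightarrow> nat filter \<Rightarrow> (nat \<Rightarrow> complex mat) set ring" where
  "metric_ultraproduct k U = bounded_seqs k Quot null_seqs k U"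


definition fin_equiv :: "(nat set \<times> nat set) set" where
  "fin_equiv = {(S, T). finite ((S - T) \<union> (T - S))}"

definition P_mod_Fin :: "nat set set set" where
  "P_mod_Fin = UNIV // fin_equiv"

text \<open>The relation \<open>A =\<^sub>S B\<close>, for \<open>A\<close>, \<open>B\<close> in \<open>MHS k\<close> and \<open>s\<close> the class of \<open>S\<close>. None of the
  choices of representatives matters. For finite \<open>S\<close> the filter is \<open>bot\<close>, so the condition is
  vacuous.\<close>

definition eq_on ::
    "nat set set \<Rightarrow> (nat \<Rightarrow> complex mat) set \<Rightarrow> (nat \<Rightarrow> complex mat) set \<Rightarrow> bool" where
  "eq_on s A B \<longleftrightarrow> (\<forall>a\<in>A. \<forall>b\<in>B. \<forall>S\<in>s.
     ((\<lambda>n. hs_norm (a n - b n)) \<longlongrightarrow> 0) (inf sequentially (principal S)))"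


definition nonprincipal_ultrafilters :: "nat filter set" where
  "nonprincipal_ultrafilters = {U. U \<noteq> bot \<and>
     (\<forall>P. eventually P U \<or> eventually (\<lambda>n. \<not> P n) U) \<and> (\<forall>n. U \<noteq> principal {n})}"

definition boundary_topology :: "nat filter topology" where
  "boundary_topology = topology_generated_by
     {{U \<in> nonprincipal_ultrafilters. \<forall>\<^sub>F n in U. n \<in> S} | S. True}"

text \<open>Self-homeomorphisms, made extensional so that equality of functions is equality on the
  space.\<close>

definition boundary_homeos :: "(nat filter \<Rightarrow> nat filter) set" where
  "boundary_homeos = {\<theta> \<in> extensional nonprincipal_ultrafilters.
     homeomorphic_map boundary_topology boundary_topology \<theta>}"

definition class_in :: "nat set set \<Rightarrow> nat filter \<Rightarrow> bool" where
  "class_in s U \<longleftrightarrow> (\<exists>S\<in>s. \<forall>\<^sub>F n in U. n \<in> S)"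

text \<open>The Stone dual of \<open>\<theta>\<close> on classes modulo finite sets, determined by
  \<open>\<theta>(U) = {S. \<theta>(S) \<in> U}\<close>. Existence and uniqueness of the described class are
  \<open>stone_dual_ex1\<close> below.\<close>

definition stone_dual :: "(nat filter \<Rightarrow> nat filter) \<Rightarrow> nat set set \<Rightarrow> nat set set" where
  "stone_dual \<theta> s = (THE t. t \<in> P_mod_Fin \<and>
     (\<forall>U\<in>nonprincipal_ultrafilters. class_in s (\<theta> U) \<longleftrightarrow> class_in t U))"

lemma ultrafilter_below:
  fixes F :: "'a filter"
  assumes "F \<noteq> bot"
  shows "\<exists>U\<le>F. U \<noteq> bot \<and> (\<forall>P. eventually P U \<or> eventually (\<lambda>n. \<not> P n) U)"
proof -
  define A where "A = {G. G \<le> F \<and> G \<noteq> bot}"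
  let ?P = "\<lambda>G H :: 'a filter. H \<le> G"
  have "\<exists>m\<in>A. \<forall>a\<in>A. ?P m a \<longrightarrow> a = m"
  proof (rule predicate_Zorn)
    show "partial_order_on A (relation_of ?P A)"
      by (auto simp: partial_order_on_def preorder_on_def refl_on_def trans_def antisym_def
          relation_of_def)
  next
    fix C assume C: "C \<in> Chains (relation_of ?P A)"
    show "\<exists>u\<in>A. \<forall>a\<in>C. ?P a u"
    proof (cases "C = {}")
      case True
      then show ?thesis using assms by (auto simp: A_def)
    next
      case False
      have CA: "C \<subseteq> A" using C by (auto simp: Chains_def relation_of_def)
      have "eventually P (Inf C) \<longleftrightarrow> (\<exists>b\<in>C. eventually P b)" for P
      proof (rule eventually_Inf_base[OF False])
        fix G H assume "G \<in> C" "H \<in> C"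
        with C have "G \<le> H \<or> H \<le> G" by (auto simp: Chains_def relation_of_def)
        then show "\<exists>x\<in>C. x \<le> inf G H" using \<open>G \<in> C\<close> \<open>H \<in> C\<close> by auto
      qed
      from this[of "\<lambda>_. False"] have "Inf C \<noteq> bot"
        using CA by (auto simp: A_def trivial_limit_def)
      moreover have "Inf C \<le> F" using False CA by (auto simp: A_def intro: Inf_lower2)
      ultimately show ?thesis by (auto simp: A_def intro: Inf_lower)
    qed
  qed
  then obtain U where U: "U \<le> F" "U \<noteq> bot" and m: "\<And>G. G \<le> U \<Longrightarrow> G \<noteq> bot \<Longrightarrow> G = U"
    by (auto simp: A_def intro: order_trans)
  have "eventually P U \<or> eventually (\<lambda>n. \<not> P n) U" for P
  proof (cases "inf U (principal {n. P n}) = bot")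
    case True
    then have "eventually (\<lambda>_. False) (inf U (principal {n. P n}))" by simp
    then show ?thesis by (simp add: eventually_inf_principal)
  next
    case False
    then have "inf U (principal {n. P n}) = U" using m by simp
    then have "U \<le> principal {n. P n}" by (metis inf.cobounded2)
    then show ?thesis by (simp add: le_principal)
  qed
  with U show ?thesis by blast
qed

lemma nonprincipal_infinite:
  assumes U: "U \<in> nonprincipal_ultrafilters" and S: "\<forall>\<^sub>F n in U. n \<in> S"
  shows "infinite S"
proof
  assume "finite S"
  have "\<forall>\<^sub>F n in U. n \<noteq> m" for m
  proof (rule ccontr)
    assume "\<not> ?thesis"
    then have ev: "\<forall>\<^sub>F n in U. n = m"
      using U unfolding nonprincipal_ultrafilters_def by fastforce
    have "U = principal {m}"
    proof (rule antisym)
      show "U \<le> principal {m}" using ev by (simp add: le_principal)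
      show "principal {m} \<le> U"
      proof (rule filter_leI)
        fix P assume P: "eventually P U"
        have "P m"
        proof (rule ccontr)
          assume "\<not> P m"
          then have "eventually (\<lambda>_. False) U" using eventually_conj[OF P ev]
            by (auto elim: eventually_mono)
          then show False using U by (auto simp: nonprincipal_ultrafilters_def trivial_limit_def)
        qed
        then show "eventually P (principal {m})" by (simp add: eventually_principal)
      qed
    qed
    then show False using U by (auto simp: nonprincipal_ultrafilters_def)
  qed
  then have "\<forall>\<^sub>F n in U. \<forall>m\<in>S. n \<noteq> m" using \<open>finite S\<close> by (simp add: eventually_ball_finite)
  then have "eventually (\<lambda>_. False) U" using S by eventually_elim blast
  then show False using U by (auto simp: nonprincipal_ultrafilters_def trivial_limit_def)
qed

lemma nonprincipal_not:
  assumes "U \<in> nonprincipal_ultrafilters"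
  shows "(\<forall>\<^sub>F n in U. \<not> P n) \<longleftrightarrow> \<not> eventually P U"
proof -
  have "\<not> (eventually P U \<and> (\<forall>\<^sub>F n in U. \<not> P n))"
  proof
    assume a: "eventually P U \<and> (\<forall>\<^sub>F n in U. \<not> P n)"
    from conjunct1[OF a] conjunct2[OF a] have "eventually (\<lambda>_. False) U"
      by eventually_elim simp
    then show False using assms by (auto simp: nonprincipal_ultrafilters_def trivial_limit_def)
  qed
  then show ?thesis using assms unfolding nonprincipal_ultrafilters_def by blast
qed

lemma nonprincipal_containing:
  assumes "infinite S"
  shows "\<exists>U\<in>nonprincipal_ultrafilters. \<forall>\<^sub>F n in U. n \<in> S"
proof -
  let ?F = "inf cofinite (principal S)"
  have "?F \<noteq> bot"
    using assms by (simp add: trivial_limit_def eventually_inf_principal eventually_cofinite)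
  then obtain U where U: "U \<le> ?F" "U \<noteq> bot"
    "\<forall>P. eventually P U \<or> eventually (\<lambda>n. \<not> P n) U"
    using ultrafilter_below by blast
  have "U \<noteq> principal {n}" for n
  proof
    assume "U = principal {n}"
    moreover have "\<forall>\<^sub>F m in U. m \<noteq> n"
      by (rule filter_leD[OF order_trans[OF U(1) inf.cobounded1]]) (simp add: eventually_cofinite)
    ultimately show False by (simp add: eventually_principal)
  qed
  moreover have "\<forall>\<^sub>F n in U. n \<in> S"
    by (rule filter_leD[OF U(1)]) (simp add: eventually_inf_principal)
  ultimately show ?thesis using U by (auto simp: nonprincipal_ultrafilters_def)
qed

lemma nonprincipal_le_iff_finite:
  "(\<forall>U\<in>nonprincipal_ultrafilters. (\<forall>\<^sub>F n in U. n \<in> S) \<longrightarrow> (\<forall>\<^sub>F n in U. n \<in> T)) \<longleftrightarrow> finite (S - T)"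
proof
  assume L: "\<forall>U\<in>nonprincipal_ultrafilters. (\<forall>\<^sub>F n in U. n \<in> S) \<longrightarrow> (\<forall>\<^sub>F n in U. n \<in> T)"
  show "finite (S - T)"
  proof (rule ccontr)
    assume "infinite (S - T)"
    then obtain U where U: "U \<in> nonprincipal_ultrafilters" "\<forall>\<^sub>F n in U. n \<in> S - T"
      using nonprincipal_containing by blast
    from U(2) have "\<forall>\<^sub>F n in U. n \<in> S" "\<forall>\<^sub>F n in U. \<not> n \<in> T" by (auto elim: eventually_mono)
    with L U(1) show False by (simp add: nonprincipal_not)
  qed
next
  assume fin: "finite (S - T)"
  show "\<forall>U\<in>nonprincipal_ultrafilters. (\<forall>\<^sub>F n in U. n \<in> S) \<longrightarrow> (\<forall>\<^sub>F n in U. n \<in> T)"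
  proof (intro ballI impI)
    fix U assume U: "U \<in> nonprincipal_ultrafilters" and S: "\<forall>\<^sub>F n in U. n \<in> S"
    have "\<forall>\<^sub>F n in U. \<not> n \<in> S - T"
      using nonprincipal_infinite[OF U] fin nonprincipal_not[OF U] by blast
    with S show "\<forall>\<^sub>F n in U. n \<in> T" by eventually_elim blast
  qed
qed

lemma equiv_fin_equiv: "equiv UNIV fin_equiv"
proof (rule equivI)
  show "trans fin_equiv"
  proof (rule transI)
    fix A B C assume "(A, B) \<in> fin_equiv" "(B, C) \<in> fin_equiv"
    then have "finite ((A - B \<union> (B - A)) \<union> (B - C \<union> (C - B)))" by (auto simp: fin_equiv_def)
    then have "finite (A - C \<union> (C - A))" by (rule rev_finite_subset) blast
    then show "(A, C) \<in> fin_equiv" by (simp add: fin_equiv_def)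
  qed
qed (auto simp: fin_equiv_def refl_on_def sym_def)

lemma class_in_image:
  assumes "U \<in> nonprincipal_ultrafilters"
  shows "class_in (fin_equiv `` {S}) U \<longleftrightarrow> (\<forall>\<^sub>F n in U. n \<in> S)"
proof
  assume "class_in (fin_equiv `` {S}) U"
  then obtain T where "finite (T - S)" "\<forall>\<^sub>F n in U. n \<in> T"
    by (auto simp: class_in_def fin_equiv_def)
  then show "\<forall>\<^sub>F n in U. n \<in> S" using assms nonprincipal_le_iff_finite by blast
next
  assume "\<forall>\<^sub>F n in U. n \<in> S"
  moreover have "S \<in> fin_equiv `` {S}" by (simp add: fin_equiv_def)
  ultimately show "class_in (fin_equiv `` {S}) U" unfolding class_in_def by blast
qed

lemma topspace_boundary: "topspace boundary_topology = nonprincipal_ultrafilters"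
proof -
  have "nonprincipal_ultrafilters \<in> {{U \<in> nonprincipal_ultrafilters. \<forall>\<^sub>F n in U. n \<in> S} |S. True}"
    by (auto intro!: exI[of _ UNIV])
  then show ?thesis unfolding boundary_topology_def topology_generated_by_topspace by auto
qed

lemma boundary_basis:
  assumes "openin boundary_topology W" "U \<in> W"
  shows "\<exists>S. (\<forall>\<^sub>F n in U. n \<in> S) \<and> {V \<in> nonprincipal_ultrafilters. \<forall>\<^sub>F n in V. n \<in> S} \<subseteq> W"
proof -
  let ?B = "{{U \<in> nonprincipal_ultrafilters. \<forall>\<^sub>F n in U. n \<in> S} | S. True}"
  have "generate_topology_on ?B W"
    using assms(1) by (simp add: boundary_topology_def openin_topology_generated_by_iff)
  then show ?thesis using assms(2)
  proof (induction arbitrary: U rule: generate_topology_on.induct)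
    case Empty
    then show ?case by simp
  next
    case (Int a b)
    then obtain S T where
      "\<forall>\<^sub>F n in U. n \<in> S" "{V \<in> nonprincipal_ultrafilters. \<forall>\<^sub>F n in V. n \<in> S} \<subseteq> a"
      "\<forall>\<^sub>F n in U. n \<in> T" "{V \<in> nonprincipal_ultrafilters. \<forall>\<^sub>F n in V. n \<in> T} \<subseteq> b"
      by (meson IntD1 IntD2)
    then show ?case by (intro exI[of _ "S \<inter> T"]) (auto simp: eventually_conj_iff)
  next
    case (UN K)
    then show ?case by (meson Union_iff Union_upper order_trans)
  next
    case (Basis s)
    then show ?case by blast
  qed
qed

lemma boundary_clopen:
  assumes op: "openin boundary_topology W"
    and opc: "openin boundary_topology (nonprincipal_ultrafilters - W)"
  shows "\<exists>T. W = {V \<in> nonprincipal_ultrafilters. \<forall>\<^sub>F n in V. n \<in> T}"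
proof -
  define h where "h S = {V \<in> nonprincipal_ultrafilters. \<forall>\<^sub>F n in V. n \<in> S}" for S
  let ?W' = "nonprincipal_ultrafilters - W"
  have W: "W \<subseteq> nonprincipal_ultrafilters" using openin_subset[OF op] topspace_boundary by simp
  have hUn: "h (A \<union> B) = h A \<union> h B" for A B
  proof -
    have "(\<forall>\<^sub>F n in V. n \<in> A \<union> B) \<longleftrightarrow> (\<forall>\<^sub>F n in V. n \<in> A) \<or> (\<forall>\<^sub>F n in V. n \<in> B)"
      if V: "V \<in> nonprincipal_ultrafilters" for V
    proof
      assume AB: "\<forall>\<^sub>F n in V. n \<in> A \<union> B"
      show "(\<forall>\<^sub>F n in V. n \<in> A) \<or> (\<forall>\<^sub>F n in V. n \<in> B)"
      proof (rule disjCI)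
        assume "\<not> (\<forall>\<^sub>F n in V. n \<in> B)"
        then have "\<forall>\<^sub>F n in V. \<not> n \<in> B" using nonprincipal_not[OF V] by blast
        with AB show "\<forall>\<^sub>F n in V. n \<in> A" by eventually_elim blast
      qed
    qed (auto elim: eventually_mono)
    then show ?thesis unfolding h_def by blast
  qed
  define J where "J = {A \<union> B | A B. h A \<subseteq> W \<and> h B \<subseteq> ?W'}"
  have J_Un: "X \<union> Y \<in> J" if XY: "X \<in> J" "Y \<in> J" for X Y
  proof -
    obtain A B where X: "X = A \<union> B" "h A \<subseteq> W" "h B \<subseteq> ?W'"
      using XY(1) unfolding J_def by blast
    obtain C D where Y: "Y = C \<union> D" "h C \<subseteq> W" "h D \<subseteq> ?W'"
      using XY(2) unfolding J_def by blast
    have "h (A \<union> C) \<subseteq> W" "h (B \<union> D) \<subseteq> ?W'"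
      unfolding hUn by (rule Un_least[OF X(2) Y(2)], rule Un_least[OF X(3) Y(3)])
    moreover have "X \<union> Y = (A \<union> C) \<union> (B \<union> D)" unfolding X(1) Y(1) by (simp add: Un_ac)
    ultimately show ?thesis
      unfolding J_def by (intro CollectI exI[of _ "A \<union> C"] exI[of _ "B \<union> D"] conjI)
  qed
  have h0: "h {} = {}" using nonprincipal_infinite unfolding h_def by blast
  have "\<exists>X\<in>J. finite (- X)"
  proof (rule ccontr)
    assume neg: "\<not> ?thesis"
    define F where "F = (INF X\<in>J. inf cofinite (principal (- X)))"
    have J0: "{} \<in> J" using h0 unfolding J_def by blast
    have ev: "eventually P F \<longleftrightarrow> (\<exists>b\<in>(\<lambda>X. inf cofinite (principal (- X))) ` J. eventually P b)" for P
      unfolding F_def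
    proof (rule eventually_Inf_base)
      show "(\<lambda>X. inf cofinite (principal (- X))) ` J \<noteq> {}" using J0 by blast
      fix G H assume "G \<in> (\<lambda>X. inf cofinite (principal (- X))) ` J"
        "H \<in> (\<lambda>X. inf cofinite (principal (- X))) ` J"
      then obtain X Y where XY: "X \<in> J" "Y \<in> J" "G = inf cofinite (principal (- X))"
        "H = inf cofinite (principal (- Y))" by blast
      have "inf cofinite (principal (- (X \<union> Y))) \<le> inf G H"
        unfolding XY by (intro inf_greatest inf_mono order_refl) auto
      then show "\<exists>x\<in>(\<lambda>X. inf cofinite (principal (- X))) ` J. x \<le> inf G H"
        using J_Un[OF XY(1,2)] by blast
    qed
    have "F \<noteq> bot"
    proof
      assume "F = bot"
      then have "eventually (\<lambda>_. False) F" by simp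
      then obtain X where "X \<in> J" "eventually (\<lambda>_. False) (inf cofinite (principal (- X)))"
        unfolding ev by blast
      then have "finite (- X)" by (simp add: eventually_inf_principal eventually_cofinite Compl_eq)
      with neg \<open>X \<in> J\<close> show False by blast
    qed
    then obtain U where U: "U \<le> F" "U \<noteq> bot"
      "\<forall>P. eventually P U \<or> eventually (\<lambda>n. \<not> P n) U" using ultrafilter_below by blast
    have le: "U \<le> inf cofinite (principal (- X))" if "X \<in> J" for X
      using U(1) INF_lower[OF that, of "\<lambda>X. inf cofinite (principal (- X))"]
      unfolding F_def by (rule order_trans)
    have "U \<noteq> principal {n}" for n
    proof
      assume "U = principal {n}"
      moreover have "\<forall>\<^sub>F m in U. m \<noteq> n"
        by (rule filter_leD[OF order_trans[OF le[OF J0] inf.cobounded1]])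
          (simp add: eventually_cofinite)
      ultimately show False by (simp add: eventually_principal)
    qed
    with U have Un: "U \<in> nonprincipal_ultrafilters" by (simp add: nonprincipal_ultrafilters_def)
    have out: "\<not> (\<forall>\<^sub>F n in U. n \<in> X)" if "X \<in> J" for X
    proof -
      have "\<forall>\<^sub>F n in U. \<not> n \<in> X"
        by (rule filter_leD[OF le[OF that]]) (simp add: eventually_inf_principal)
      then show ?thesis using nonprincipal_not[OF Un] by blast
    qed
    show False
    proof (cases "U \<in> W")
      case True
      then obtain S where S: "\<forall>\<^sub>F n in U. n \<in> S" "h S \<subseteq> W" using boundary_basis[OF op] unfolding h_def by blast
      have "S \<union> {} \<in> J" using S h0 unfolding J_def by blast
      with out S show False by simp
    next
      case False
      then obtain S where S: "\<forall>\<^sub>F n in U. n \<in> S" "h S \<subseteq> ?W'"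
        using boundary_basis[OF opc] Un unfolding h_def by blast
      have "{} \<union> S \<in> J" using S h0 unfolding J_def by blast
      with out S show False by simp
    qed
  qed
  then obtain A B where AB: "finite (- (A \<union> B))" "h A \<subseteq> W" "h B \<subseteq> ?W'" unfolding J_def by blast
  have "h (A \<union> B) = nonprincipal_ultrafilters"
  proof -
    have "\<forall>\<^sub>F n in V. n \<in> A \<union> B" if "V \<in> nonprincipal_ultrafilters" for V
      using AB(1) nonprincipal_le_iff_finite[of UNIV "A \<union> B"] that by (simp add: Compl_eq_Diff_UNIV)
    then show ?thesis unfolding h_def by blast
  qed
  then have "W = h A" using AB W unfolding hUn by blast
  then show ?thesis unfolding h_def by blast
qed

lemma stone_dual_ex1:
  assumes \<theta>: "\<theta> \<in> boundary_homeos" and s: "s \<in> P_mod_Fin"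
  shows "\<exists>!t. t \<in> P_mod_Fin \<and>
     (\<forall>U\<in>nonprincipal_ultrafilters. class_in s (\<theta> U) \<longleftrightarrow> class_in t U)"
proof -
  obtain S where S: "s = fin_equiv `` {S}" using s by (auto simp: P_mod_Fin_def quotient_def)
  have cont: "continuous_map boundary_topology boundary_topology \<theta>"
    using \<theta> by (auto simp: boundary_homeos_def homeomorphic_imp_continuous_map)
  have img: "\<theta> U \<in> nonprincipal_ultrafilters" if "U \<in> nonprincipal_ultrafilters" for U
    using cont that by (auto simp: continuous_map_def topspace_boundary)
  have basic: "openin boundary_topology {U \<in> nonprincipal_ultrafilters. \<forall>\<^sub>F n in U. n \<in> T}" for T
    unfolding boundary_topology_def by (rule topology_generated_by_Basis) blast
  have pre: "openin boundary_topology {U \<in> nonprincipal_ultrafilters. \<forall>\<^sub>F n in \<theta> U. n \<in> T}" for T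
    using openin_continuous_map_preimage[OF cont basic[of T]]
    by (rule back_subst[of "openin boundary_topology"]) (auto simp: topspace_boundary img)
  have "nonprincipal_ultrafilters - {U \<in> nonprincipal_ultrafilters. \<forall>\<^sub>F n in \<theta> U. n \<in> S}
      = {U \<in> nonprincipal_ultrafilters. \<forall>\<^sub>F n in \<theta> U. n \<in> - S}"
    using nonprincipal_not[OF img] by auto
  then obtain T where T: "{U \<in> nonprincipal_ultrafilters. \<forall>\<^sub>F n in \<theta> U. n \<in> S}
      = {U \<in> nonprincipal_ultrafilters. \<forall>\<^sub>F n in U. n \<in> T}"
    using boundary_clopen[OF pre[of S]] pre[of "- S"] by auto
  show ?thesis
  proof (rule ex1I[of _ "fin_equiv `` {T}"])
    show "fin_equiv `` {T} \<in> P_mod_Fin \<and> (\<forall>U\<in>nonprincipal_ultrafilters.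
        class_in s (\<theta> U) \<longleftrightarrow> class_in (fin_equiv `` {T}) U)"
    proof (intro conjI ballI)
      show "fin_equiv `` {T} \<in> P_mod_Fin" by (simp add: P_mod_Fin_def quotientI)
      fix U assume U: "U \<in> nonprincipal_ultrafilters"
      have "(\<forall>\<^sub>F n in \<theta> U. n \<in> S) \<longleftrightarrow> (\<forall>\<^sub>F n in U. n \<in> T)" using T U by blast
      then show "class_in s (\<theta> U) \<longleftrightarrow> class_in (fin_equiv `` {T}) U"
        using U img[OF U] by (simp add: S class_in_image)
    qed
  next
    fix t assume t: "t \<in> P_mod_Fin \<and>
      (\<forall>U\<in>nonprincipal_ultrafilters. class_in s (\<theta> U) \<longleftrightarrow> class_in t U)"
    then obtain T' where T': "t = fin_equiv `` {T'}" by (auto simp: P_mod_Fin_def quotient_def)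
    have "(\<forall>\<^sub>F n in U. n \<in> T) \<longleftrightarrow> (\<forall>\<^sub>F n in U. n \<in> T')" if "U \<in> nonprincipal_ultrafilters" for U
    proof -
      have "(\<forall>\<^sub>F n in \<theta> U. n \<in> S) \<longleftrightarrow> (\<forall>\<^sub>F n in U. n \<in> T)" using T that by blast
      moreover have "class_in s (\<theta> U) \<longleftrightarrow> class_in t U" using t that by blast
      ultimately show ?thesis using that img[OF that] by (simp add: S T' class_in_image)
    qed
    then have "finite (T - T')" "finite (T' - T)"
      unfolding nonprincipal_le_iff_finite[symmetric] by simp_all
    then have "(T', T) \<in> fin_equiv" by (simp add: fin_equiv_def)
    then show "t = fin_equiv `` {T}"
      unfolding T' by (rule equiv_class_eq[OF equiv_fin_equiv])
  qed
qed


definition transports_equality ::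
    "(nat \<Rightarrow> nat) \<Rightarrow> ((nat \<Rightarrow> complex mat) set \<Rightarrow> (nat \<Rightarrow> complex mat) set)
      \<Rightarrow> (nat filter \<Rightarrow> nat filter) \<Rightarrow> bool" where
  "transports_equality k \<phi> \<theta> \<longleftrightarrow>
     (\<forall>A\<in>carrier (MHS k). \<forall>B\<in>carrier (MHS k). \<forall>s\<in>P_mod_Fin.
        eq_on s A B \<longleftrightarrow> eq_on (stone_dual \<theta> s) (\<phi> A) (\<phi> B))"

definition induces ::
    "(nat \<Rightarrow> nat) \<Rightarrow> nat filter \<Rightarrow> (nat \<Rightarrow> nat) \<Rightarrow> nat filter
      \<Rightarrow> ((nat \<Rightarrow> complex mat) set \<Rightarrow> (nat \<Rightarrow> complex mat) set)
      \<Rightarrow> ((nat \<Rightarrow> complex mat) set \<Rightarrow> (nat \<Rightarrow> complex mat) set) \<Rightarrow> bool" where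
  "induces k V l U \<phi> \<psi> \<longleftrightarrow>
     (\<forall>a\<in>carrier (bounded_seqs k). \<forall>b\<in>carrier (bounded_seqs l).
        \<phi> (seq_class k sequentially a) = seq_class l sequentially b
        \<longrightarrow> \<psi> (seq_class k V a) = seq_class l U b)"

end

theory Submission
  imports Defs "HOL-Analysis.L2_Norm"
begin

text \<open>
  A ring isomorphism carries central idempotents to central idempotents, and the central idempotents
  of \<open>MHS k\<close> are exactly the classes of sequences of zeros and ones, that is, the elements of
  \<open>P(\<nat>)/Fin\<close>. For this, a sequence that asymptotically commutes with all bounded sequences is
  asymptotically scalar: commutators with a diagonal projection (chosen by a maximal cut of the index
  set) control the off-diagonal part of a matrix, and commutators with a cyclic shift control the
  spread of the diagonal. Since \<open>a =\<^sub>S b\<close> says that the projection of \<open>S\<close> multiplies \<open>a\<close> and \<open>b\<close>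
  to the same element, the induced automorphism of \<open>P(\<nat>)/Fin\<close> transports these relations, and
  testing on projections shows that it is the only one to do so.

  For the ultraproducts one needs that the norm of \<open>a\<close> tends to zero along \<open>\<theta>(U)\<close> iff that of a lift
  of \<open>\<phi>(a)\<close> does along \<open>U\<close>. No set in the ultrafilter need witness such a convergence, but a failure
  of the equivalence already occurs on an infinite pseudo-intersection of countably many sets of
  \<open>U\<close>, where it contradicts the transport of \<open>=\<^sub>S\<close>.
\<close>

section \<open>Operator norm and Hilbert--Schmidt norm\<close>

lemma scalar_prod_conjugate_self:
  fixes v :: "complex vec"
  shows "v \<bullet> conjugate v = of_real (\<Sum>i<dim_vec v. (cmod (v $ i))\<^sup>2)"
  unfolding scalar_prod_def lessThan_atLeast0 of_real_sum
  by (simp add: complex_norm_square del: of_real_power)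

text \<open>This form makes the Minkowski and Cauchy-Schwarz inequalities for \<open>L2_set\<close>
  available for vectors and, over pairs of indices, for matrices.\<close>

lemma vec_norm2_L2: "vec_norm2 v = L2_set (\<lambda>i. cmod (v $ i)) {..<dim_vec v}"
  unfolding vec_norm2_def L2_set_def by (simp only: scalar_prod_conjugate_self Re_complex_of_real)

lemma vec_norm2_nonneg: "0 \<le> vec_norm2 v"
  by (simp add: vec_norm2_L2)

lemma vec_norm2_smult: "vec_norm2 (c \<cdot>\<^sub>v v) = cmod c * vec_norm2 v"
  by (auto simp: vec_norm2_L2 norm_mult L2_set_right_distrib intro!: L2_set_cong)

lemma vec_norm2_triangle:
  assumes "dim_vec v = dim_vec w"
  shows "vec_norm2 (v + w) \<le> vec_norm2 v + vec_norm2 w"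
proof -
  have "vec_norm2 (v + w) \<le> L2_set (\<lambda>i. cmod (v $ i) + cmod (w $ i)) {..<dim_vec w}"
    unfolding vec_norm2_L2 using assms by (auto intro!: L2_set_mono norm_triangle_ineq)
  also have "\<dots> \<le> vec_norm2 v + vec_norm2 w"
    unfolding vec_norm2_L2 assms by (rule L2_set_triangle_ineq)
  finally show ?thesis .
qed

lemma scalar_prod_norm_le:
  assumes "dim_vec v = dim_vec w"
  shows "cmod (v \<bullet> w) \<le> vec_norm2 v * vec_norm2 w"
proof -
  have "cmod (v \<bullet> w) \<le> (\<Sum>i<dim_vec w. \<bar>cmod (v $ i)\<bar> * \<bar>cmod (w $ i)\<bar>)"
    unfolding scalar_prod_def lessThan_atLeast0 by (rule norm_sum[THEN order_trans]) (simp add: norm_mult)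
  also have "\<dots> \<le> vec_norm2 v * vec_norm2 w"
    unfolding vec_norm2_L2 assms by (rule L2_set_mult_ineq)
  finally show ?thesis .
qed

lemma vec_norm2_conjugate: "vec_norm2 (conjugate v) = vec_norm2 v"
  by (auto simp: vec_norm2_L2 intro!: L2_set_cong)

lemma vec_norm2_sq: "of_real ((vec_norm2 v)\<^sup>2) = v \<bullet> conjugate v"
  by (simp add: scalar_prod_conjugate_self vec_norm2_L2 L2_set_def sum_nonneg)

text \<open>The constant is crude: Cauchy-Schwarz in each row gives the unnormalised Hilbert-Schmidt
  norm of A. Its purpose is to make the supremum in \<open>op_norm\<close> finite, without which
  \<open>SUP\<close> over the reals carries no information.\<close>

lemma mult_vec_norm2_bound:
  "\<exists>C\<ge>0. \<forall>v\<in>carrier_vec (dim_col A). vec_norm2 (A *\<^sub>v v) \<le> C * vec_norm2 v"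
proof (intro exI[of _ "L2_set (\<lambda>i. vec_norm2 (row A i)) {..<dim_row A}"] conjI ballI)
  fix v :: "complex vec" assume v: "v \<in> carrier_vec (dim_col A)"
  have "vec_norm2 (A *\<^sub>v v) \<le> L2_set (\<lambda>i. vec_norm2 (row A i) * vec_norm2 v) {..<dim_row A}"
    unfolding vec_norm2_L2[of "A *\<^sub>v v"] using v
    by (auto intro!: L2_set_mono scalar_prod_norm_le)
  then show "vec_norm2 (A *\<^sub>v v) \<le> L2_set (\<lambda>i. vec_norm2 (row A i)) {..<dim_row A} * vec_norm2 v"
    by (simp add: L2_set_left_distrib vec_norm2_nonneg)
qed simp

section \<open>Operator norm of sums, products and transposes\<close>

lemma op_norm_bdd:
  "bdd_above ((\<lambda>v. vec_norm2 (A *\<^sub>v v)) ` {v \<in> carrier_vec (dim_col A). vec_norm2 v \<le> 1})"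
proof -
  obtain C where C: "C \<ge> 0" "\<And>v. v \<in> carrier_vec (dim_col A) \<Longrightarrow> vec_norm2 (A *\<^sub>v v) \<le> C * vec_norm2 v"
    using mult_vec_norm2_bound[of A] by blast
  have "vec_norm2 (A *\<^sub>v v) \<le> C" if "v \<in> carrier_vec (dim_col A)" "vec_norm2 v \<le> 1" for v
    using C(2)[OF that(1)] mult_left_mono[OF that(2) C(1)] by simp
  then show ?thesis by (intro bdd_aboveI2[of _ _ C]) blast
qed

lemma op_norm_leI:
  assumes "0 \<le> C" "\<And>v. v \<in> carrier_vec (dim_col A) \<Longrightarrow> vec_norm2 (A *\<^sub>v v) \<le> C * vec_norm2 v"
  shows "op_norm A \<le> C"
  unfolding op_norm_def
proof (rule cSUP_least)
  have "0\<^sub>v (dim_col A) \<in> {v \<in> carrier_vec (dim_col A). vec_norm2 v \<le> 1}"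
    by (simp add: vec_norm2_L2 L2_set_def)
  then show "{v \<in> carrier_vec (dim_col A). vec_norm2 v \<le> 1} \<noteq> {}" by blast
  fix v assume v: "v \<in> {v \<in> carrier_vec (dim_col A). vec_norm2 v \<le> 1}"
  then have "vec_norm2 (A *\<^sub>v v) \<le> C * vec_norm2 v" using assms(2) by blast
  also have "\<dots> \<le> C" using v mult_left_mono[of "vec_norm2 v" 1 C] assms(1) by simp
  finally show "vec_norm2 (A *\<^sub>v v) \<le> C" .
qed

lemma op_norm_nonneg: "0 \<le> op_norm A"
proof -
  have "0\<^sub>v (dim_col A) \<in> {v \<in> carrier_vec (dim_col A). vec_norm2 v \<le> 1}"
    by (simp add: vec_norm2_L2 L2_set_def)
  from cSUP_upper[OF this op_norm_bdd] show ?thesis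
    unfolding op_norm_def using vec_norm2_nonneg order_trans by blast
qed

lemma op_norm_apply:
  assumes v: "v \<in> carrier_vec (dim_col A)"
  shows "vec_norm2 (A *\<^sub>v v) \<le> op_norm A * vec_norm2 v"
proof (cases "vec_norm2 v = 0")
  case True
  \<comment> \<open>A null vector cannot be rescaled to the unit ball; here the crude bound already
    gives that \<open>A *\<^sub>v v\<close> has norm zero.\<close>
  then show ?thesis using mult_vec_norm2_bound[of A] v by fastforce
next
  case False
  define c where "c = complex_of_real (1 / vec_norm2 v)"
  have pos: "vec_norm2 v > 0" using False vec_norm2_nonneg[of v] by simp
  have "vec_norm2 (A *\<^sub>v (c \<cdot>\<^sub>v v)) \<le> op_norm A"
    unfolding op_norm_def
    by (rule cSUP_upper[OF _ op_norm_bdd])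
      (use v pos in \<open>simp add: vec_norm2_smult c_def norm_divide\<close>)
  moreover have "A *\<^sub>v (c \<cdot>\<^sub>v v) = c \<cdot>\<^sub>v (A *\<^sub>v v)"
    using v by (intro mult_mat_vec[of _ "dim_row A" "dim_col A"]) auto
  ultimately show ?thesis using pos by (simp add: vec_norm2_smult c_def norm_divide field_simps)
qed

lemma op_norm_add:
  assumes "A \<in> carrier_mat n m" "B \<in> carrier_mat n m"
  shows "op_norm (A + B) \<le> op_norm A + op_norm B"
proof (rule op_norm_leI)
  fix v :: "complex vec" assume "v \<in> carrier_vec (dim_col (A + B))"
  then have v: "v \<in> carrier_vec m" using assms by simp
  have "vec_norm2 ((A + B) *\<^sub>v v) \<le> vec_norm2 (A *\<^sub>v v) + vec_norm2 (B *\<^sub>v v)"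
    using assms v by (simp add: add_mult_distrib_mat_vec vec_norm2_triangle)
  also have "\<dots> \<le> op_norm A * vec_norm2 v + op_norm B * vec_norm2 v"
    using assms v by (intro add_mono op_norm_apply) auto
  finally show "vec_norm2 ((A + B) *\<^sub>v v) \<le> (op_norm A + op_norm B) * vec_norm2 v"
    by (simp add: ring_distribs)
qed (simp add: op_norm_nonneg)

lemma op_norm_mult:
  assumes "A \<in> carrier_mat n m" "B \<in> carrier_mat m p"
  shows "op_norm (A * B) \<le> op_norm A * op_norm B"
proof (rule op_norm_leI)
  fix v :: "complex vec" assume "v \<in> carrier_vec (dim_col (A * B))"
  then have v: "v \<in> carrier_vec p" using assms by simp
  have "vec_norm2 ((A * B) *\<^sub>v v) = vec_norm2 (A *\<^sub>v (B *\<^sub>v v))"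
    using assms v by (simp add: assoc_mult_mat_vec)
  also have "\<dots> \<le> op_norm A * vec_norm2 (B *\<^sub>v v)"
    using assms v by (intro op_norm_apply) auto
  also have "\<dots> \<le> op_norm A * (op_norm B * vec_norm2 v)"
    using assms v by (intro mult_left_mono op_norm_apply) (auto simp: op_norm_nonneg)
  finally show "vec_norm2 ((A * B) *\<^sub>v v) \<le> op_norm A * op_norm B * vec_norm2 v"
    by (simp add: mult.assoc)
qed (simp add: op_norm_nonneg)

lemma op_norm_smult: "op_norm (c \<cdot>\<^sub>m A) \<le> cmod c * op_norm A"
proof (rule op_norm_leI)
  fix v :: "complex vec" assume "v \<in> carrier_vec (dim_col (c \<cdot>\<^sub>m A))"
  then have v: "v \<in> carrier_vec (dim_col A)" by simp
  have "(c \<cdot>\<^sub>m A) *\<^sub>v v = c \<cdot>\<^sub>v (A *\<^sub>v v)" using v by (intro eq_vecI) auto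
  then show "vec_norm2 ((c \<cdot>\<^sub>m A) *\<^sub>v v) \<le> cmod c * op_norm A * vec_norm2 v"
    using op_norm_apply[OF v] by (simp add: vec_norm2_smult mult.assoc mult_left_mono)
qed (simp add: op_norm_nonneg)

lemma op_norm_minus:
  assumes "A \<in> carrier_mat n m" "B \<in> carrier_mat n m"
  shows "op_norm (A - B) \<le> op_norm A + op_norm B"
proof -
  have "A - B = A + (-1) \<cdot>\<^sub>m B" using assms by (intro eq_matI) auto
  then show ?thesis using op_norm_add[OF assms(1), of "(-1) \<cdot>\<^sub>m B"] assms op_norm_smult[of "-1" B] by simp
qed

lemma op_norm_one: "op_norm (1\<^sub>m n) \<le> 1"
  by (rule op_norm_leI) auto

lemma op_norm_zero: "op_norm (0\<^sub>m n m) = 0"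
proof -
  have "op_norm (0\<^sub>m n m) \<le> 0"
    by (rule op_norm_leI) (auto simp: vec_norm2_L2 L2_set_def)
  with op_norm_nonneg show ?thesis by (rule antisym[rotated])
qed

text \<open>Duality: for w the image of v, the square of its norm is the pairing of v with A applied
  to the conjugate of w, so Cauchy-Schwarz and the bound for A leave one factor norm of w to cancel.
  The transpose is what turns left multiplication estimates into right ones.\<close>

lemma op_norm_transpose: "op_norm (A\<^sup>T) \<le> op_norm A"
proof (rule op_norm_leI[OF op_norm_nonneg])
  fix v :: "complex vec" assume "v \<in> carrier_vec (dim_col (A\<^sup>T))"
  then have v: "v \<in> carrier_vec (dim_row A)" by simp
  define w where "w = A\<^sup>T *\<^sub>v v"
  have w: "w \<in> carrier_vec (dim_col A)" by (rule carrier_vecI) (simp add: w_def)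
  have "complex_of_real ((vec_norm2 w)\<^sup>2) = (A\<^sup>T *\<^sub>v v) \<bullet> conjugate w"
    unfolding w_def by (rule vec_norm2_sq)
  also have "\<dots> = v \<bullet> (A *\<^sub>v conjugate w)"
    by (rule transpose_vec_mult_scalar[of _ "dim_row A" "dim_col A"]) (use v w in auto)
  finally have "cmod (of_real ((vec_norm2 w)\<^sup>2)) = cmod (v \<bullet> (A *\<^sub>v conjugate w))" by simp
  then have "(vec_norm2 w)\<^sup>2 = cmod (v \<bullet> (A *\<^sub>v conjugate w))"
    by (simp del: of_real_power)
  also have "\<dots> \<le> vec_norm2 v * vec_norm2 (A *\<^sub>v conjugate w)"
    using v by (intro scalar_prod_norm_le) auto
  also have "\<dots> \<le> vec_norm2 v * (op_norm A * vec_norm2 (conjugate w))"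
    using w by (intro mult_left_mono op_norm_apply) (auto simp: vec_norm2_nonneg)
  finally have "vec_norm2 w * vec_norm2 w \<le> (op_norm A * vec_norm2 v) * vec_norm2 w"
    by (simp add: power2_eq_square vec_norm2_conjugate mult_ac)
  then show "vec_norm2 (A\<^sup>T *\<^sub>v v) \<le> op_norm A * vec_norm2 v"
    unfolding w_def[symmetric]
    by (cases "vec_norm2 w = 0") (auto simp: vec_norm2_nonneg op_norm_nonneg less_le)
qed

section \<open>Normalised Hilbert-Schmidt norm\<close>

lemma hs_norm_L2:
  assumes "A \<in> carrier_mat n n"
  shows "hs_norm A = L2_set (\<lambda>(i, j). cmod (A $$ (i, j))) ({..<n} \<times> {..<n}) / sqrt (real n)"
proof -
  have "mat_trace (mat_adjoint A * A) = (\<Sum>j<n. \<Sum>i<n. of_real ((cmod (A $$ (i, j)))\<^sup>2))"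
    unfolding mat_trace_def lessThan_atLeast0 using assms
    by (auto simp: mat_adjoint_def scalar_prod_def complex_norm_square mult.commute
        mat_of_rows_def simp del: of_real_power intro!: sum.cong)
  also have "\<dots> = of_real (\<Sum>i<n. \<Sum>j<n. (cmod (A $$ (i, j)))\<^sup>2)"
    by (subst sum.swap) simp
  finally show ?thesis using assms unfolding hs_norm_def L2_set_def
    by (simp add: real_sqrt_divide sum.cartesian_product case_prod_unfold)
qed

lemma hs_norm_sq:
  assumes "A \<in> carrier_mat n n" 
  shows "(hs_norm A)\<^sup>2 = (\<Sum>i<n. \<Sum>j<n. (cmod (A $$ (i, j)))\<^sup>2) / real n"
  by (simp add: hs_norm_L2[OF assms] power_divide L2_set_def sum_nonneg sum.cartesian_product
      case_prod_unfold)

lemma hs_norm_nonneg: "A \<in> carrier_mat n n \<Longrightarrow> 0 \<le> hs_norm A"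
  by (simp add: hs_norm_L2)

lemma hs_norm_triangle:
  assumes "A \<in> carrier_mat n n" "B \<in> carrier_mat n n"
  shows "hs_norm (A + B) \<le> hs_norm A + hs_norm B"
proof -
  have "L2_set (\<lambda>(i, j). cmod ((A + B) $$ (i, j))) ({..<n} \<times> {..<n})
      \<le> L2_set (\<lambda>p. (\<lambda>(i, j). cmod (A $$ (i, j))) p + (\<lambda>(i, j). cmod (B $$ (i, j))) p) ({..<n} \<times> {..<n})"
    using assms by (intro L2_set_mono) (auto intro: norm_triangle_ineq)
  also have "\<dots> \<le> L2_set (\<lambda>(i, j). cmod (A $$ (i, j))) ({..<n} \<times> {..<n}) +
      L2_set (\<lambda>(i, j). cmod (B $$ (i, j))) ({..<n} \<times> {..<n})"
    by (rule L2_set_triangle_ineq)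
  finally show ?thesis
    using assms by (simp add: hs_norm_L2[of _ n] divide_right_mono flip: add_divide_distrib)
qed

lemma hs_norm_smult:
  assumes "A \<in> carrier_mat n n"
  shows "hs_norm (c \<cdot>\<^sub>m A) = cmod c * hs_norm A"
proof -
  have "L2_set (\<lambda>(i, j). cmod ((c \<cdot>\<^sub>m A) $$ (i, j))) ({..<n} \<times> {..<n})
      = L2_set (\<lambda>p. cmod c * (\<lambda>(i, j). cmod (A $$ (i, j))) p) ({..<n} \<times> {..<n})"
    using assms by (intro L2_set_cong) (auto simp: norm_mult)
  then show ?thesis using assms by (simp add: hs_norm_L2[of _ n] L2_set_right_distrib)
qed

lemma hs_norm_minus_commute:
  assumes "A \<in> carrier_mat n n" "B \<in> carrier_mat n n"
  shows "hs_norm (A - B) = hs_norm (B - A)"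
proof -
  have "A - B = (-1) \<cdot>\<^sub>m (B - A)" using assms by (intro eq_matI) auto
  then show ?thesis using hs_norm_smult[of "B - A" n "-1"] assms by (simp add: minus_carrier_mat)
qed

lemma hs_norm_diff_triangle:
  assumes "A \<in> carrier_mat n n" "B \<in> carrier_mat n n" "C \<in> carrier_mat n n"
  shows "hs_norm (A - C) \<le> hs_norm (A - B) + hs_norm (B - C)"
proof -
  have "A - C = (A - B) + (B - C)" using assms by (intro eq_matI) auto
  then show ?thesis using hs_norm_triangle[of "A - B" n "B - C"] assms by (simp add: minus_carrier_mat)
qed

lemma hs_norm_transpose:
  assumes "A \<in> carrier_mat n n"
  shows "hs_norm (A\<^sup>T) = hs_norm A"
proof -
  have "(hs_norm (A\<^sup>T))\<^sup>2 = (hs_norm A)\<^sup>2"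
    using assms by (simp add: hs_norm_sq[of _ n]) (rule disjI2, rule sum.swap)
  then show ?thesis using hs_norm_nonneg[of A n] hs_norm_nonneg[of "A\<^sup>T" n] assms by simp
qed

text \<open>Left multiplication acts column by column, so in this form an operator norm bound on
  vectors becomes a bound on the Hilbert-Schmidt norm.\<close>

lemma hs_norm_cols:
  assumes "A \<in> carrier_mat n n"
  shows "hs_norm A = L2_set (\<lambda>j. vec_norm2 (col A j)) {..<n} / sqrt (real n)"
proof -
  have "(\<Sum>j<n. (vec_norm2 (col A j))\<^sup>2) = (\<Sum>j<n. \<Sum>i<n. (cmod (A $$ (i, j)))\<^sup>2)"
    using assms by (intro sum.cong) (auto simp: vec_norm2_L2 L2_set_def sum_nonneg)
  also have "\<dots> = (\<Sum>i<n. \<Sum>j<n. (cmod (A $$ (i, j)))\<^sup>2)" by (rule sum.swap)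
  finally show ?thesis unfolding hs_norm_L2[OF assms] L2_set_def
    by (simp add: sum.cartesian_product case_prod_unfold)
qed

lemma hs_norm_mult_left:
  assumes "A \<in> carrier_mat n n" "B \<in> carrier_mat n n"
  shows "hs_norm (A * B) \<le> op_norm A * hs_norm B"
proof -
  have "L2_set (\<lambda>j. vec_norm2 (col (A * B) j)) {..<n} \<le> L2_set (\<lambda>j. op_norm A * vec_norm2 (col B j)) {..<n}"
    using assms
    by (intro L2_set_mono) (auto simp: vec_norm2_nonneg op_norm_apply col_mult2[of _ n n _ n] simp del: col_mult)
  then show ?thesis using assms
    by (simp add: hs_norm_cols[of _ n] L2_set_right_distrib[symmetric] op_norm_nonneg divide_right_mono)
qed

text \<open>Transposition preserves the Hilbert-Schmidt norm, does not increase the operator norm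
  and reverses products, which reduces the claim to left multiplication.\<close>

lemma hs_norm_mult_right:
  assumes "A \<in> carrier_mat n n" "B \<in> carrier_mat n n"
  shows "hs_norm (A * B) \<le> hs_norm A * op_norm B"
proof -
  have "hs_norm (A * B) = hs_norm (B\<^sup>T * A\<^sup>T)"
    using assms by (metis hs_norm_transpose mult_carrier_mat transpose_mult)
  also have "\<dots> \<le> op_norm (B\<^sup>T) * hs_norm (A\<^sup>T)"
    using assms by (intro hs_norm_mult_left[of _ n]) auto
  also have "\<dots> \<le> op_norm B * hs_norm A"
    using assms op_norm_transpose[of B]
    by (simp add: hs_norm_transpose mult_right_mono hs_norm_nonneg)
  finally show ?thesis by (simp add: mult.commute)
qed

lemma hs_norm_one: "0 < n \<Longrightarrow> hs_norm (1\<^sub>m n) = 1"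
proof -
  assume n: "0 < n"
  have "(hs_norm (1\<^sub>m n))\<^sup>2 = (\<Sum>i<n. \<Sum>j<n. if i = j then 1 else 0) / real n"
    unfolding hs_norm_sq[OF one_carrier_mat]
    by (intro arg_cong2[of _ _ _ _ "(/)"] sum.cong refl) auto
  also have "\<dots> = 1" using n by (simp add: sum.delta)
  finally show ?thesis using hs_norm_nonneg[of "1\<^sub>m n" n] by (simp add: power2_eq_1_iff)
qed

lemma hs_norm_zero: "hs_norm (0\<^sub>m n n) = 0"
  using hs_norm_sq[OF zero_carrier_mat, of n] by simp

section \<open>Distance to the scalars\<close>

text \<open>Greedy construction: indices are added one at a time, each to the side for which more of
  its weight to the earlier indices crosses the cut. At least half of that weight then crosses, so
  half of the total does. No symmetry of f is assumed; \<open>h\<close> adds up both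
  directions.\<close>

lemma max_cut:
  fixes f :: "'a \<Rightarrow> 'a \<Rightarrow> real"
  assumes "finite I" "\<And>i j. 0 \<le> f i j"
  shows "\<exists>T\<subseteq>I. (\<Sum>i\<in>I. \<Sum>j\<in>I. if i = j then 0 else f i j)
    \<le> 2 * (\<Sum>i\<in>I. \<Sum>j\<in>I. if i \<in> T \<longleftrightarrow> j \<in> T then 0 else f i j)"
  using assms(1)
proof induction
  case empty
  then show ?case by simp
next
  case (insert x I)
  then obtain T where T: "T \<subseteq> I" "(\<Sum>i\<in>I. \<Sum>j\<in>I. if i = j then 0 else f i j)
      \<le> 2 * (\<Sum>i\<in>I. \<Sum>j\<in>I. if i \<in> T \<longleftrightarrow> j \<in> T then 0 else f i j)" (is "?S \<le> 2 * ?C") by blast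
  define h where "h j = f x j + f j x" for j
  \<comment> \<open>The new row and column are separated for a general relation P, because the same
    computation serves for equality and for lying on the same side, with x outside the cut set and
    with x inside it.\<close>
  have split: "(\<Sum>i\<in>insert x I. \<Sum>j\<in>insert x I. if P i j then 0 else f i j)
      = (\<Sum>i\<in>I. \<Sum>j\<in>I. if P i j then 0 else f i j) + (\<Sum>j\<in>I. if P x j then 0 else h j)"
    if "\<And>i j. P i j \<longleftrightarrow> P j i" "P x x" for P
  proof -
    let ?g = "\<lambda>i j. if P i j then 0 else f i j"
    have "(\<Sum>i\<in>insert x I. \<Sum>j\<in>insert x I. ?g i j)
        = (?g x x + (\<Sum>j\<in>I. ?g x j)) + (\<Sum>i\<in>I. ?g i x + (\<Sum>j\<in>I. ?g i j))"
      using insert(1,2) by (simp only: sum.insert not_False_eq_True)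
    also have "\<dots> = (\<Sum>i\<in>I. \<Sum>j\<in>I. ?g i j) + (\<Sum>j\<in>I. ?g x j + ?g j x)"
      using that(2) by (simp only: sum.distrib if_True)
    also have "(\<Sum>j\<in>I. ?g x j + ?g j x) = (\<Sum>j\<in>I. if P x j then 0 else h j)"
      using that(1)[of x] by (intro sum.cong refl) (auto simp: h_def)
    finally show ?thesis .
  qed
  have tot: "(\<Sum>i\<in>insert x I. \<Sum>j\<in>insert x I. if i = j then 0 else f i j) = ?S + (\<Sum>j\<in>I. h j)"
    by (subst split) (use insert(2) in \<open>auto intro!: sum.cong\<close>)
  have c1: "(\<Sum>i\<in>insert x I. \<Sum>j\<in>insert x I. if i \<in> T \<longleftrightarrow> j \<in> T then 0 else f i j)
      = ?C + (\<Sum>j\<in>I. if j \<in> T then h j else 0)"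
    by (subst split) (use insert(2) T(1) in \<open>auto intro!: sum.cong\<close>)
  have c2: "(\<Sum>i\<in>insert x I. \<Sum>j\<in>insert x I. if i \<in> insert x T \<longleftrightarrow> j \<in> insert x T then 0 else f i j)
      = ?C + (\<Sum>j\<in>I. if j \<in> T then 0 else h j)"
    by (subst split; (intro arg_cong2[of _ _ _ _ "(+)"] sum.cong refl)?) (use insert(2) in auto)
  \<comment> \<open>The larger of the two possible gains a and b is at least half of their
    sum.\<close>
  have half: "s + (a + b) \<le> 2 * (c + a) \<or> s + (a + b) \<le> 2 * (c + b)" if "s \<le> 2 * c"
    for s a b c :: real by (cases "a \<le> b") (use that in auto)
  have "(\<Sum>j\<in>I. h j) = (\<Sum>j\<in>I. if j \<in> T then h j else 0) + (\<Sum>j\<in>I. if j \<in> T then 0 else h j)"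
    by (subst sum.distrib[symmetric]) (intro sum.cong refl, auto)
  then have "?S + (\<Sum>j\<in>I. h j) \<le> 2 * (?C + (\<Sum>j\<in>I. if j \<in> T then h j else 0)) \<or>
      ?S + (\<Sum>j\<in>I. h j) \<le> 2 * (?C + (\<Sum>j\<in>I. if j \<in> T then 0 else h j))"
    using half[OF T(2)] by (simp only:)
  then show ?case
  proof
    assume "?S + (\<Sum>j\<in>I. h j) \<le> 2 * (?C + (\<Sum>j\<in>I. if j \<in> T then h j else 0))"
    then show ?thesis using T(1) unfolding tot c1[symmetric] by blast
  next
    assume "?S + (\<Sum>j\<in>I. h j) \<le> 2 * (?C + (\<Sum>j\<in>I. if j \<in> T then 0 else h j))"
    then show ?thesis using T(1) unfolding tot c2[symmetric] by (intro exI[of _ "insert x T"]) auto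
  qed
qed

text \<open>Take W to be the diagonal projection onto T. Entry (i, j) of the commutator is then the
  entry of A, up to sign, if T separates i from j, and zero otherwise. A cut carrying half of the
  off-diagonal weight lets a single W control all of it, at the price of the factor 2.\<close>

lemma off_diagonal_le_commutator:
  assumes A: "A \<in> carrier_mat n n"
  shows "\<exists>W\<in>carrier_mat n n. op_norm W \<le> 1 \<and>
    (\<Sum>i<n. \<Sum>j<n. if i = j then 0 else (cmod (A $$ (i, j)))\<^sup>2)
      \<le> 2 * (real n * (hs_norm (A * W - W * A))\<^sup>2)"
proof -
  obtain T where T: "(\<Sum>i<n. \<Sum>j<n. if i = j then 0 else (cmod (A $$ (i, j)))\<^sup>2)
    \<le> 2 * (\<Sum>i<n. \<Sum>j<n. if i \<in> T \<longleftrightarrow> j \<in> T then 0 else (cmod (A $$ (i, j)))\<^sup>2)"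
    using max_cut[of "{..<n}" "\<lambda>i j. (cmod (A $$ (i, j)))\<^sup>2"] by auto
  define W :: "complex mat" where "W = mat n n (\<lambda>(i, j). if i = j then (if i \<in> T then 1 else 0) else 0)"
  have W: "W \<in> carrier_mat n n" by (simp add: W_def)
  have ent: "(A * W - W * A) $$ (i, j) = A $$ (i, j) * ((if j \<in> T then 1 else 0) - (if i \<in> T then 1 else 0))"
    if "i < n" "j < n" for i j
  proof -
    have "(A * W) $$ (i, j) = (\<Sum>m<n. A $$ (i, m) * W $$ (m, j))"
      using that A W by (simp add: scalar_prod_def lessThan_atLeast0)
    also have "\<dots> = (\<Sum>m<n. if m = j then A $$ (i, j) * (if j \<in> T then 1 else 0) else 0)"
      using that by (intro sum.cong refl) (auto simp: W_def)
    finally have AW: "(A * W) $$ (i, j) = (\<Sum>m<n. if m = j then A $$ (i, j) * (if j \<in> T then 1 else 0) else 0)" .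
    have "(W * A) $$ (i, j) = (\<Sum>m<n. W $$ (i, m) * A $$ (m, j))"
      using that A W by (simp add: scalar_prod_def lessThan_atLeast0)
    also have "\<dots> = (\<Sum>m<n. if m = i then A $$ (i, j) * (if i \<in> T then 1 else 0) else 0)"
      using that by (intro sum.cong refl) (auto simp: W_def)
    finally have WA: "(W * A) $$ (i, j) = (\<Sum>m<n. if m = i then A $$ (i, j) * (if i \<in> T then 1 else 0) else 0)" .
    show ?thesis using that A W AW WA by (simp add: sum.delta right_diff_distrib del: index_mult_mat(1))
  qed
  have "op_norm W \<le> 1"
  proof (rule op_norm_leI)
    fix v :: "complex vec" assume "v \<in> carrier_vec (dim_col W)"
    then have v: "dim_vec v = n" by (simp add: W_def)
    have "(W *\<^sub>v v) $ i = (if i \<in> T then v $ i else 0)" if "i < n" for i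
    proof -
      have "(W *\<^sub>v v) $ i = (\<Sum>m<n. W $$ (i, m) * v $ m)"
        using that v W by (simp add: scalar_prod_def lessThan_atLeast0)
      also have "\<dots> = (\<Sum>m<n. if m = i then (if i \<in> T then v $ i else 0) else 0)"
        using that by (intro sum.cong refl) (auto simp: W_def)
      finally show ?thesis using that by (simp add: sum.delta)
    qed
    then show "vec_norm2 (W *\<^sub>v v) \<le> 1 * vec_norm2 v"
      using v by (auto simp: vec_norm2_L2 W_def intro!: L2_set_mono)
  qed simp
  moreover have "real n * (hs_norm (A * W - W * A))\<^sup>2
      = (\<Sum>i<n. \<Sum>j<n. if i \<in> T \<longleftrightarrow> j \<in> T then 0 else (cmod (A $$ (i, j)))\<^sup>2)"
  \<comment> \<open>Recovering the entry sum from \<open>hs_norm\<close> cancels the normalising n,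
    so size zero, where both sides vanish, is split off.\<close>
  proof (cases "n = 0")
    case False
    have "A * W - W * A \<in> carrier_mat n n" using A W by auto
    then show ?thesis using False
      by (simp add: hs_norm_sq ent norm_mult power_mult_distrib del: index_minus_mat)
        (auto intro!: sum.cong)
  qed simp
  ultimately show ?thesis using T W by auto
qed

text \<open>For the permutation matrix W of p, the commutator has the difference of two diagonal
  entries of A at each position (p j, j). W only permutes coordinates, hence is isometric.\<close>

lemma permutation_le_commutator:
  assumes A: "A \<in> carrier_mat n n" and p: "bij_betw p {..<n} {..<n}"
  shows "\<exists>W\<in>carrier_mat n n. op_norm W \<le> 1 \<and>
    (\<Sum>j<n. (cmod (A $$ (p j, p j) - A $$ (j, j)))\<^sup>2) \<le> real n * (hs_norm (A * W - W * A))\<^sup>2"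
proof -
  define W :: "complex mat" where "W = mat n n (\<lambda>(i, j). if i = p j then 1 else 0)"
  have W: "W \<in> carrier_mat n n" by (simp add: W_def)
  have pn: "p j < n" if "j < n" for j using p that by (auto dest: bij_betwE)
  have peq: "p i = p j \<longleftrightarrow> i = j" if "i < n" "j < n" for i j
    using p that by (auto simp: bij_betw_def inj_on_def)
  have ent: "(A * W - W * A) $$ (p j, j) = A $$ (p j, p j) - A $$ (j, j)" if "j < n" for j
  proof -
    have "(A * W) $$ (p j, j) = (\<Sum>m<n. A $$ (p j, m) * W $$ (m, j))"
      using that A W pn by (simp add: scalar_prod_def lessThan_atLeast0)
    also have "\<dots> = (\<Sum>m<n. if m = p j then A $$ (p j, p j) else 0)"
      using that by (intro sum.cong refl) (auto simp: W_def)
    finally have AW: "(A * W) $$ (p j, j) = (\<Sum>m<n. if m = p j then A $$ (p j, p j) else 0)" .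
    have "(W * A) $$ (p j, j) = (\<Sum>m<n. W $$ (p j, m) * A $$ (m, j))"
      using that A W pn by (simp add: scalar_prod_def lessThan_atLeast0)
    also have "\<dots> = (\<Sum>m<n. if m = j then A $$ (j, j) else 0)"
      using that pn peq by (intro sum.cong refl) (auto simp: W_def)
    finally have WA: "(W * A) $$ (p j, j) = (\<Sum>m<n. if m = j then A $$ (j, j) else 0)" .
    show ?thesis using that A W pn AW WA by (simp add: sum.delta del: index_mult_mat(1))
  qed
  have "op_norm W \<le> 1"
  proof (rule op_norm_leI)
    fix v :: "complex vec" assume "v \<in> carrier_vec (dim_col W)"
    then have v: "dim_vec v = n" by (simp add: W_def)
    have Wv: "(W *\<^sub>v v) $ p i = v $ i" if "i < n" for i
    proof -
      have "(W *\<^sub>v v) $ p i = (\<Sum>m<n. W $$ (p i, m) * v $ m)"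
        using that v W pn by (simp add: scalar_prod_def lessThan_atLeast0)
      also have "\<dots> = (\<Sum>m<n. if m = i then v $ i else 0)"
        using that pn peq by (intro sum.cong refl) (auto simp: W_def)
      finally show ?thesis using that by (simp add: sum.delta)
    qed
    have "(\<Sum>i<n. (cmod ((W *\<^sub>v v) $ i))\<^sup>2) = (\<Sum>i<n. (cmod ((W *\<^sub>v v) $ p i))\<^sup>2)"
      by (rule sum.reindex_bij_betw[OF p, symmetric])
    also have "\<dots> = (\<Sum>i<n. (cmod (v $ i))\<^sup>2)" by (simp add: Wv)
    finally show "vec_norm2 (W *\<^sub>v v) \<le> 1 * vec_norm2 v"
      using v by (simp add: vec_norm2_L2 L2_set_def W_def)
  qed simp
  moreover have "(\<Sum>j<n. (cmod (A $$ (p j, p j) - A $$ (j, j)))\<^sup>2) \<le> real n * (hs_norm (A * W - W * A))\<^sup>2"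
  proof (cases "n = 0")
    case False
    have "A * W - W * A \<in> carrier_mat n n" using A W by auto
    then have "real n * (hs_norm (A * W - W * A))\<^sup>2 = (\<Sum>i<n. \<Sum>j<n. (cmod ((A * W - W * A) $$ (i, j)))\<^sup>2)"
      using False by (simp add: hs_norm_sq del: index_minus_mat)
    also have "\<dots> = (\<Sum>j<n. \<Sum>i<n. (cmod ((A * W - W * A) $$ (i, j)))\<^sup>2)" by (rule sum.swap)
    \<comment> \<open>In column j all entries but the one in row p j are dropped.\<close>
    also have "\<dots> \<ge> (\<Sum>j<n. (cmod ((A * W - W * A) $$ (p j, j)))\<^sup>2)"
      using pn by (intro sum_mono) (rule member_le_sum, auto)
    also have "(\<Sum>j<n. (cmod ((A * W - W * A) $$ (p j, j)))\<^sup>2) = (\<Sum>j<n. (cmod (A $$ (p j, p j) - A $$ (j, j)))\<^sup>2)"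
      by (intro sum.cong refl) (simp only: ent lessThan_iff)
    finally show ?thesis .
  qed simp
  ultimately show ?thesis using W by blast
qed

text \<open>Averaging over all shifts \<open>p\<close> of the index set and over all choices of \<open>s\<close> gives the same
  double sum.\<close>

lemma exists_shift_dominating:
  fixes d :: "nat \<Rightarrow> nat \<Rightarrow> real"
  assumes "0 < n"
  shows "\<exists>s<n. \<exists>p. bij_betw p {..<n} {..<n} \<and> (\<Sum>j<n. d j s) \<le> (\<Sum>j<n. d (p j) j)"
proof (rule ccontr)
  assume neg: "\<not> ?thesis"
  \<comment> \<open>The cyclic shift, that is j + t modulo n. Its symmetry in t and j makes p j a
    bijection also when the shift parameter is the variable of summation.\<close>
  define p where "p t j = (if j + t < n then j + t else j + t - n)" for t j :: nat
  have bij: "bij_betw (p t) {..<n} {..<n}" if "t < n" for t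
  proof -
    have inj: "inj_on (p t) {..<n}" using that by (auto simp: inj_on_def p_def split: if_splits)
    moreover have "p t ` {..<n} \<subseteq> {..<n}" using that by (auto simp: p_def)
    ultimately show ?thesis by (simp add: bij_betw_def endo_inj_surj)
  qed
  have sym: "p t j = p j t" for t j by (simp add: p_def add.commute)
  \<comment> \<open>The negated claim is used with s = t and the shift by t. Summing these strict
    inequalities over t gives a contradiction, as both sides become the sum of d over all
    pairs.\<close>
  have "(\<Sum>j<n. d (p t j) j) < (\<Sum>j<n. d j t)" if "t < n" for t
    using neg that bij[OF that] not_less by blast
  then have "(\<Sum>t<n. \<Sum>j<n. d (p t j) j) < (\<Sum>t<n. \<Sum>j<n. d j t)"
    by (rule sum_strict_mono[rotated 2]) (use assms in auto)
  moreover have "(\<Sum>t<n. \<Sum>j<n. d (p t j) j) = (\<Sum>j<n. \<Sum>t<n. d (p j t) j)"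
    by (subst sum.swap) (simp add: sym)
  moreover have "\<dots> = (\<Sum>j<n. \<Sum>t<n. d t j)"
    by (intro sum.cong refl sum.reindex_bij_betw bij) simp
  ultimately show False by simp
qed

text \<open>The square of the distance splits into the off-diagonal part, controlled by V with the
  constant 2 of the cut, and the deviation of the diagonal from c, controlled by a shift W. The
  bound does not depend on n, which is what allows n to grow along a sequence.\<close>

lemma dist_scalar_le_commutators:
  assumes A: "A \<in> carrier_mat n n" and n: "0 < n"
  shows "\<exists>c. \<exists>V\<in>carrier_mat n n. \<exists>W\<in>carrier_mat n n. op_norm V \<le> 1 \<and> op_norm W \<le> 1 \<and>
    (hs_norm (A - c \<cdot>\<^sub>m 1\<^sub>m n))\<^sup>2 \<le> 2 * (hs_norm (A * V - V * A))\<^sup>2 + (hs_norm (A * W - W * A))\<^sup>2"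
proof -
  obtain V where V: "V \<in> carrier_mat n n" "op_norm V \<le> 1"
    "(\<Sum>i<n. \<Sum>j<n. if i = j then 0 else (cmod (A $$ (i, j)))\<^sup>2) \<le> 2 * (real n * (hs_norm (A * V - V * A))\<^sup>2)"
    using off_diagonal_le_commutator[OF A] by blast
  obtain s p where sp: "s < n" "bij_betw p {..<n} {..<n}"
    "(\<Sum>j<n. (cmod (A $$ (j, j) - A $$ (s, s)))\<^sup>2) \<le> (\<Sum>j<n. (cmod (A $$ (p j, p j) - A $$ (j, j)))\<^sup>2)"
    using exists_shift_dominating[OF n, of "\<lambda>i j. (cmod (A $$ (i, i) - A $$ (j, j)))\<^sup>2"] by blast
  obtain W where W: "W \<in> carrier_mat n n" "op_norm W \<le> 1"
    "(\<Sum>j<n. (cmod (A $$ (p j, p j) - A $$ (j, j)))\<^sup>2) \<le> real n * (hs_norm (A * W - W * A))\<^sup>2"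
    using permutation_le_commutator[OF A sp(2)] by blast
  \<comment> \<open>The scalar is a diagonal entry chosen by averaging, so that the deviations from
    it are dominated by those along one shift.\<close>
  define c where "c = A $$ (s, s)"
  have "A - c \<cdot>\<^sub>m 1\<^sub>m n \<in> carrier_mat n n" by auto
  then have "real n * (hs_norm (A - c \<cdot>\<^sub>m 1\<^sub>m n))\<^sup>2
      = (\<Sum>i<n. \<Sum>j<n. (cmod ((A - c \<cdot>\<^sub>m 1\<^sub>m n) $$ (i, j)))\<^sup>2)"
    using n by (simp add: hs_norm_sq del: index_minus_mat)
  also have "\<dots> = (\<Sum>i<n. \<Sum>j<n. (if i = j then 0 else (cmod (A $$ (i, j)))\<^sup>2) +
      (if i = j then (cmod (A $$ (i, i) - c))\<^sup>2 else 0))"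
    using A by (intro sum.cong refl) auto
  also have "\<dots> = (\<Sum>i<n. \<Sum>j<n. if i = j then 0 else (cmod (A $$ (i, j)))\<^sup>2) +
      (\<Sum>i<n. (cmod (A $$ (i, i) - c))\<^sup>2)"
    by (simp add: sum.distrib sum.delta')
  also have "\<dots> \<le> real n * (2 * (hs_norm (A * V - V * A))\<^sup>2 + (hs_norm (A * W - W * A))\<^sup>2)"
    using V(3) sp(3) W(3) unfolding c_def by (simp add: algebra_simps)
  finally have "(hs_norm (A - c \<cdot>\<^sub>m 1\<^sub>m n))\<^sup>2 \<le> 2 * (hs_norm (A * V - V * A))\<^sup>2 + (hs_norm (A * W - W * A))\<^sup>2"
    using n by simp
  then show ?thesis using V W by blast
qed

text \<open>For B = A - c the identity c(c - 1) = (A A - A) - (A B + (c - 1) B) shows that c almost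
  solves c c = c. Hence c is near 0 or near 1, and so is A, with an error that depends on n only
  through \<open>hs_norm\<close> of B and of A A - A.\<close>

lemma near_idempotent_scalar:
  assumes A: "A \<in> carrier_mat n n" and n: "0 < n" and C: "op_norm A \<le> C"
    and e: "hs_norm (A - c \<cdot>\<^sub>m 1\<^sub>m n) \<le> e"
  shows "min (hs_norm A) (hs_norm (A - 1\<^sub>m n)) \<le> e + 2 * (hs_norm (A * A - A) + e * (2 * C + 1 + e))"
proof -
  define B where "B = A - c \<cdot>\<^sub>m 1\<^sub>m n"
  have B: "B \<in> carrier_mat n n" by (auto simp: B_def)
  have hB: "hs_norm B \<le> e" using e by (simp add: B_def)
  have e0: "0 \<le> e" using hs_norm_nonneg[OF B] hB by simp
  have I: "hs_norm (d \<cdot>\<^sub>m 1\<^sub>m n) = cmod d" for d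
    using n by (simp add: hs_norm_smult[of _ n] hs_norm_one)
  have neg: "hs_norm (- X) = hs_norm X" if "X \<in> carrier_mat n n" for X
  proof -
    have "- X = (-1) \<cdot>\<^sub>m X" by (intro eq_matI) auto
    then show ?thesis using hs_norm_smult[OF that, of "-1"] by simp
  qed
  \<comment> \<open>Multiplying by the identity, which has normalised norm 1, bounds the
    Hilbert-Schmidt norm of A by its operator norm; this in turn bounds the modulus of c.\<close>
  have hA: "hs_norm A \<le> C"
    using hs_norm_mult_left[OF A one_carrier_mat] A C n by (simp add: hs_norm_one)
  have "c \<cdot>\<^sub>m 1\<^sub>m n = A + (- B)" using A by (intro eq_matI) (auto simp: B_def)
  then have "cmod c \<le> hs_norm A + hs_norm (- B)"
    using hs_norm_triangle[OF A, of "- B"] B I[of c] by simp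
  then have c: "cmod c \<le> C + e" using hA hB neg[OF B] by simp
  have AB: "A * B = A * A - c \<cdot>\<^sub>m A"
    unfolding B_def using A by (simp add: mult_minus_distrib_mat[of _ n n _ n] mult_smult_distrib[of _ n n _ n])
  have X: "A * A - A \<in> carrier_mat n n" using A by (intro minus_carrier_mat)
  have "(c * (c - 1)) \<cdot>\<^sub>m 1\<^sub>m n = (A * A - A) + - (A * B + (c - 1) \<cdot>\<^sub>m B)"
    unfolding AB using A by (intro eq_matI) (auto simp: B_def algebra_simps simp del: index_mult_mat(1))
  then have "cmod (c * (c - 1)) \<le> hs_norm (A * A - A) + hs_norm (- (A * B + (c - 1) \<cdot>\<^sub>m B))"
    using hs_norm_triangle[OF X, of "- (A * B + (c - 1) \<cdot>\<^sub>m B)"] A B I[of "c * (c - 1)"] by simp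
  also have "hs_norm (- (A * B + (c - 1) \<cdot>\<^sub>m B)) = hs_norm (A * B + (c - 1) \<cdot>\<^sub>m B)"
    using A B by (intro neg) auto
  also have "\<dots> \<le> hs_norm (A * B) + hs_norm ((c - 1) \<cdot>\<^sub>m B)"
    using A B by (intro hs_norm_triangle[of _ n]) auto
  also have "\<dots> \<le> C * e + (C + e + 1) * e"
  proof (rule add_mono)
    have "hs_norm (A * B) \<le> op_norm A * hs_norm B" using A B by (rule hs_norm_mult_left)
    also have "\<dots> \<le> C * e"
      using C hB op_norm_nonneg[of A] hs_norm_nonneg[OF B] by (intro mult_mono) auto
    finally show "hs_norm (A * B) \<le> C * e" .
    have "cmod (c - 1) \<le> C + e + 1" using c norm_triangle_ineq4[of c 1] by simp
    then show "hs_norm ((c - 1) \<cdot>\<^sub>m B) \<le> (C + e + 1) * e"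
      unfolding hs_norm_smult[OF B] using hB hs_norm_nonneg[OF B]
      by (intro mult_mono) (auto intro: order_trans[OF norm_ge_zero])
  qed
  also have "C * e + (C + e + 1) * e = e * (2 * C + 1 + e)" by (simp add: algebra_simps)
  finally have cc: "cmod c * cmod (c - 1) \<le> hs_norm (A * A - A) + e * (2 * C + 1 + e)" (is "_ \<le> ?d")
    unfolding norm_mult by simp
  \<comment> \<open>One of the two factors is at least 1/2, so the other is at most twice the bound
    on the product. This is the origin of the factor 2 in the conclusion.\<close>
  have "1 \<le> cmod c + cmod (c - 1)" using norm_triangle_ineq4[of c "c - 1"] by simp
  then have "1/2 \<le> cmod (c - 1) \<or> 1/2 \<le> cmod c" by linarith
  then have "cmod c \<le> 2 * ?d \<or> cmod (c - 1) \<le> 2 * ?d"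
  proof
    assume "1/2 \<le> cmod (c - 1)"
    then have "cmod c * (1/2) \<le> cmod c * cmod (c - 1)" by (intro mult_left_mono) auto
    with cc show ?thesis by simp
  next
    assume "1/2 \<le> cmod c"
    then have "(1/2) * cmod (c - 1) \<le> cmod c * cmod (c - 1)" by (intro mult_right_mono) auto
    with cc show ?thesis by simp
  qed
  moreover have "hs_norm A \<le> e + cmod c"
  proof -
    have "A = B + c \<cdot>\<^sub>m 1\<^sub>m n" using A by (intro eq_matI) (auto simp: B_def)
    then show ?thesis using hs_norm_triangle[OF B, of "c \<cdot>\<^sub>m 1\<^sub>m n"] I[of c] hB by simp
  qed
  moreover have "hs_norm (A - 1\<^sub>m n) \<le> e + cmod (c - 1)"
  proof -
    have "A - 1\<^sub>m n = B + (c - 1) \<cdot>\<^sub>m 1\<^sub>m n" using A by (intro eq_matI) (auto simp: B_def)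
    then show ?thesis using hs_norm_triangle[OF B, of "(c - 1) \<cdot>\<^sub>m 1\<^sub>m n"] I[of "c - 1"] hB by simp
  qed
  ultimately show ?thesis by linarith
qed

section \<open>Quotients of the ring of bounded sequences\<close>

lemma bounded_seqs_simps:
  "a \<in> carrier (bounded_seqs k) \<longleftrightarrow> (\<forall>n. a n \<in> carrier_mat (k n) (k n)) \<and> (\<exists>C. \<forall>n. op_norm (a n) \<le> C)"
  "a \<otimes>\<^bsub>bounded_seqs k\<^esub> b = (\<lambda>n. a n * b n)"
  "\<one>\<^bsub>bounded_seqs k\<^esub> = (\<lambda>n. 1\<^sub>m (k n))"
  "\<zero>\<^bsub>bounded_seqs k\<^esub> = (\<lambda>n. 0\<^sub>m (k n) (k n))"
  "a \<oplus>\<^bsub>bounded_seqs k\<^esub> b = (\<lambda>n. a n + b n)"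
  by (simp_all add: bounded_seqs_def)

lemma bounded_seqs_carrier_mat:
  "a \<in> carrier (bounded_seqs k) \<Longrightarrow> a n \<in> carrier_mat (k n) (k n)"
  by (simp add: bounded_seqs_simps)

lemma bounded_seqs_memI:
  "(\<And>n. a n \<in> carrier_mat (k n) (k n)) \<Longrightarrow> (\<And>n. op_norm (a n) \<le> C) \<Longrightarrow> a \<in> carrier (bounded_seqs k)"
  by (auto simp: bounded_seqs_simps)

lemma bounded_seqs_add:
  assumes "a \<in> carrier (bounded_seqs k)" "b \<in> carrier (bounded_seqs k)"
  shows "(\<lambda>n. a n + b n) \<in> carrier (bounded_seqs k)"
proof -
  note cm = bounded_seqs_carrier_mat[OF assms(1)] bounded_seqs_carrier_mat[OF assms(2)]
  obtain C D where CD: "\<And>n. op_norm (a n) \<le> C" "\<And>n. op_norm (b n) \<le> D"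
    using assms by (auto simp: bounded_seqs_simps)
  show ?thesis
  proof (rule bounded_seqs_memI)
    show "a n + b n \<in> carrier_mat (k n) (k n)" for n
      using cm[of n] by (simp add: minus_carrier_mat)
    show "op_norm (a n + b n) \<le> C + D" for n
      using op_norm_add[OF cm, of n] add_mono[OF CD, of n n]
      by (rule order_trans)
  qed
qed

lemma bounded_seqs_minus:
  assumes "a \<in> carrier (bounded_seqs k)" "b \<in> carrier (bounded_seqs k)"
  shows "(\<lambda>n. a n - b n) \<in> carrier (bounded_seqs k)"
proof -
  note cm = bounded_seqs_carrier_mat[OF assms(1)] bounded_seqs_carrier_mat[OF assms(2)]
  obtain C D where CD: "\<And>n. op_norm (a n) \<le> C" "\<And>n. op_norm (b n) \<le> D"
    using assms by (auto simp: bounded_seqs_simps)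
  show ?thesis
  proof (rule bounded_seqs_memI)
    show "a n - b n \<in> carrier_mat (k n) (k n)" for n
      using cm[of n] by (simp add: minus_carrier_mat)
    show "op_norm (a n - b n) \<le> C + D" for n
      using op_norm_minus[OF cm, of n] add_mono[OF CD, of n n]
      by (rule order_trans)
  qed
qed

lemma bounded_seqs_mult:
  assumes "a \<in> carrier (bounded_seqs k)" "b \<in> carrier (bounded_seqs k)"
  shows "(\<lambda>n. a n * b n) \<in> carrier (bounded_seqs k)"
proof -
  note cm = bounded_seqs_carrier_mat[OF assms(1)] bounded_seqs_carrier_mat[OF assms(2)]
  obtain C D where CD: "\<And>n. op_norm (a n) \<le> C" "\<And>n. op_norm (b n) \<le> D"
    using assms by (auto simp: bounded_seqs_simps)
  show ?thesis
  proof (rule bounded_seqs_memI)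
    show "a n * b n \<in> carrier_mat (k n) (k n)" for n
      using cm[of n] by (simp add: minus_carrier_mat)
    show "op_norm (a n * b n) \<le> C * D" for n
      using op_norm_mult[OF cm, of n] mult_mono[OF CD order_trans[OF op_norm_nonneg CD(1)] op_norm_nonneg, of n n]
      by (rule order_trans)
  qed
qed

lemma bounded_seqs_one: "(\<lambda>n. 1\<^sub>m (k n)) \<in> carrier (bounded_seqs k)"
  by (rule bounded_seqs_memI[of _ _ 1]) (auto simp: op_norm_one)

lemma bounded_seqs_zero: "(\<lambda>n. 0\<^sub>m (k n) (k n)) \<in> carrier (bounded_seqs k)"
  by (rule bounded_seqs_memI[of _ _ 0]) (auto simp: op_norm_zero)

lemma ring_bounded_seqs: "ring (bounded_seqs k)"
proof (rule ringI)
  note cm = bounded_seqs_carrier_mat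
  show "abelian_group (bounded_seqs k)"
  proof (rule abelian_groupI)
    fix a b assume a: "a \<in> carrier (bounded_seqs k)" and b: "b \<in> carrier (bounded_seqs k)"
    show "a \<oplus>\<^bsub>bounded_seqs k\<^esub> b \<in> carrier (bounded_seqs k)"
      unfolding bounded_seqs_simps(5) by (rule bounded_seqs_add[OF a b])
    show "a \<oplus>\<^bsub>bounded_seqs k\<^esub> b = b \<oplus>\<^bsub>bounded_seqs k\<^esub> a"
      unfolding bounded_seqs_simps(5) by (rule ext) (rule comm_add_mat[OF cm[OF a] cm[OF b]])
    fix c assume c: "c \<in> carrier (bounded_seqs k)"
    show "a \<oplus>\<^bsub>bounded_seqs k\<^esub> b \<oplus>\<^bsub>bounded_seqs k\<^esub> c = a \<oplus>\<^bsub>bounded_seqs k\<^esub> (b \<oplus>\<^bsub>bounded_seqs k\<^esub> c)"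
      unfolding bounded_seqs_simps(5) by (rule ext) (rule assoc_add_mat[OF cm[OF a] cm[OF b] cm[OF c]])
  next
    show "\<zero>\<^bsub>bounded_seqs k\<^esub> \<in> carrier (bounded_seqs k)"
      unfolding bounded_seqs_simps(4) by (rule bounded_seqs_zero)
  next
    fix a assume a: "a \<in> carrier (bounded_seqs k)"
    show "\<zero>\<^bsub>bounded_seqs k\<^esub> \<oplus>\<^bsub>bounded_seqs k\<^esub> a = a"
      unfolding bounded_seqs_simps(4,5) by (rule ext) (rule left_add_zero_mat[OF cm[OF a]])
    have "(\<lambda>n. 0\<^sub>m (k n) (k n) - a n) \<in> carrier (bounded_seqs k)"
      by (rule bounded_seqs_minus[OF bounded_seqs_zero a])
    moreover have "(\<lambda>n. (0\<^sub>m (k n) (k n) - a n) + a n) = (\<lambda>n. 0\<^sub>m (k n) (k n))"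
    proof
      show "(0\<^sub>m (k n) (k n) - a n) + a n = 0\<^sub>m (k n) (k n)" for n
        by (rule eq_matI) (use cm[OF a, of n] in auto)
    qed
    ultimately show "\<exists>y\<in>carrier (bounded_seqs k). y \<oplus>\<^bsub>bounded_seqs k\<^esub> a = \<zero>\<^bsub>bounded_seqs k\<^esub>"
      unfolding bounded_seqs_simps(4,5) by (intro bexI[of _ "\<lambda>n. 0\<^sub>m (k n) (k n) - a n"])
  qed
  show "Group.monoid (bounded_seqs k)"
  proof (rule monoidI)
    fix a b assume a: "a \<in> carrier (bounded_seqs k)" and b: "b \<in> carrier (bounded_seqs k)"
    show "a \<otimes>\<^bsub>bounded_seqs k\<^esub> b \<in> carrier (bounded_seqs k)"
      unfolding bounded_seqs_simps(2) by (rule bounded_seqs_mult[OF a b])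
    fix c assume c: "c \<in> carrier (bounded_seqs k)"
    show "a \<otimes>\<^bsub>bounded_seqs k\<^esub> b \<otimes>\<^bsub>bounded_seqs k\<^esub> c = a \<otimes>\<^bsub>bounded_seqs k\<^esub> (b \<otimes>\<^bsub>bounded_seqs k\<^esub> c)"
      unfolding bounded_seqs_simps(2) by (rule ext) (rule assoc_mult_mat[OF cm[OF a] cm[OF b] cm[OF c]])
  next
    show "\<one>\<^bsub>bounded_seqs k\<^esub> \<in> carrier (bounded_seqs k)"
      unfolding bounded_seqs_simps(3) by (rule bounded_seqs_one)
  next
    fix a assume a: "a \<in> carrier (bounded_seqs k)"
    show "\<one>\<^bsub>bounded_seqs k\<^esub> \<otimes>\<^bsub>bounded_seqs k\<^esub> a = a"
      unfolding bounded_seqs_simps(2,3) by (rule ext) (rule left_mult_one_mat[OF cm[OF a]])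
    show "a \<otimes>\<^bsub>bounded_seqs k\<^esub> \<one>\<^bsub>bounded_seqs k\<^esub> = a"
      unfolding bounded_seqs_simps(2,3) by (rule ext) (rule right_mult_one_mat[OF cm[OF a]])
  qed
  fix a b c assume a: "a \<in> carrier (bounded_seqs k)" and b: "b \<in> carrier (bounded_seqs k)"
    and c: "c \<in> carrier (bounded_seqs k)"
  show "(a \<oplus>\<^bsub>bounded_seqs k\<^esub> b) \<otimes>\<^bsub>bounded_seqs k\<^esub> c
      = a \<otimes>\<^bsub>bounded_seqs k\<^esub> c \<oplus>\<^bsub>bounded_seqs k\<^esub> b \<otimes>\<^bsub>bounded_seqs k\<^esub> c"
    unfolding bounded_seqs_simps(2,5)
    by (rule ext) (rule add_mult_distrib_mat[OF cm[OF a] cm[OF b] cm[OF c]])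
  show "c \<otimes>\<^bsub>bounded_seqs k\<^esub> (a \<oplus>\<^bsub>bounded_seqs k\<^esub> b)
      = c \<otimes>\<^bsub>bounded_seqs k\<^esub> a \<oplus>\<^bsub>bounded_seqs k\<^esub> c \<otimes>\<^bsub>bounded_seqs k\<^esub> b"
    unfolding bounded_seqs_simps(2,5)
    by (rule ext) (rule mult_add_distrib_mat[OF cm[OF c] cm[OF a] cm[OF b]])
qed

section \<open>Null sequences along a filter and their cosets\<close>

lemma null_seqs_dominatedI:
  assumes a: "a \<in> carrier (bounded_seqs k)"
    and le: "\<And>n. hs_norm (a n) \<le> f n" and f: "(f \<longlongrightarrow> 0) F"
  shows "a \<in> null_seqs k F"
proof -
  have "((\<lambda>n. hs_norm (a n)) \<longlongrightarrow> 0) F"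
    by (rule tendsto_sandwich[OF always_eventually always_eventually tendsto_const f])
      (use le hs_norm_nonneg[OF bounded_seqs_carrier_mat[OF a]] in auto)
  with a show ?thesis by (simp add: null_seqs_def)
qed

text \<open>Absorption on both sides holds because multiplication by an operator norm bounded
  sequence enlarges \<open>hs_norm\<close> by at most a constant factor. The filter is arbitrary, so
  that \<open>MHS\<close> and all ultraproducts are covered at once.\<close>

lemma ideal_null_seqs: "ideal (null_seqs k F) (bounded_seqs k)"
proof (rule idealI[OF ring_bounded_seqs])
  interpret R: ring "bounded_seqs k" by (rule ring_bounded_seqs)
  have car: "a \<in> null_seqs k F \<Longrightarrow> a \<in> carrier (bounded_seqs k)" for a by (simp add: null_seqs_def)
  have lim: "a \<in> null_seqs k F \<Longrightarrow> ((\<lambda>n. hs_norm (a n)) \<longlongrightarrow> 0) F" for a by (simp add: null_seqs_def)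
  show "subgroup (null_seqs k F) (add_monoid (bounded_seqs k))"
  proof (rule R.add.subgroupI)
    show "null_seqs k F \<subseteq> carrier (bounded_seqs k)" using car by blast
    have "(\<lambda>n. 0\<^sub>m (k n) (k n)) \<in> null_seqs k F"
      by (rule null_seqs_dominatedI[OF bounded_seqs_zero, of _ "\<lambda>_. 0"]) (simp_all add: hs_norm_zero)
    then show "null_seqs k F \<noteq> {}" by blast
  next
    fix a assume a: "a \<in> null_seqs k F"
    let ?m = "\<lambda>n. 0\<^sub>m (k n) (k n) - a n"
    have m: "?m \<in> carrier (bounded_seqs k)" by (rule bounded_seqs_minus[OF bounded_seqs_zero car[OF a]])
    have "?m \<oplus>\<^bsub>bounded_seqs k\<^esub> a = \<zero>\<^bsub>bounded_seqs k\<^esub>" unfolding bounded_seqs_simps(2-)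
    proof
      show "(0\<^sub>m (k n) (k n) - a n) + a n = 0\<^sub>m (k n) (k n)" for n
        by (rule eq_matI) (use bounded_seqs_carrier_mat[OF car[OF a], of n] in auto)
    qed
    then have "\<ominus>\<^bsub>bounded_seqs k\<^esub> a = ?m" using m car[OF a] R.minus_equality by blast
    moreover have "hs_norm (?m n) = hs_norm (a n)" for n
    proof -
      have "a n - 0\<^sub>m (k n) (k n) = a n"
        by (rule eq_matI) (use bounded_seqs_carrier_mat[OF car[OF a], of n] in auto)
      then show ?thesis
        using hs_norm_minus_commute[OF bounded_seqs_carrier_mat[OF car[OF a], of n] zero_carrier_mat] by simp
    qed
    ultimately show "\<ominus>\<^bsub>bounded_seqs k\<^esub> a \<in> null_seqs k F"
      using null_seqs_dominatedI[OF m, of "\<lambda>n. hs_norm (a n)"] lim[OF a] by simp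
  next
    fix a b assume a: "a \<in> null_seqs k F" and b: "b \<in> null_seqs k F"
    show "a \<oplus>\<^bsub>bounded_seqs k\<^esub> b \<in> null_seqs k F" unfolding bounded_seqs_simps(2-)
      by (rule null_seqs_dominatedI[OF bounded_seqs_add[OF car[OF a] car[OF b]]
            hs_norm_triangle[OF bounded_seqs_carrier_mat[OF car[OF a]] bounded_seqs_carrier_mat[OF car[OF b]]]])
        (use tendsto_add[OF lim[OF a] lim[OF b]] in simp)
  qed
  fix a b assume a: "a \<in> null_seqs k F" and b: "b \<in> carrier (bounded_seqs k)"
  note ca = bounded_seqs_carrier_mat[OF car[OF a]] and cb = bounded_seqs_carrier_mat[OF b]
  obtain C where C: "\<And>n. op_norm (b n) \<le> C" using b by (auto simp: bounded_seqs_simps)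
  have l0: "((\<lambda>n. C * hs_norm (a n)) \<longlongrightarrow> 0) F" using tendsto_mult_left[OF lim[OF a], of C] by simp
  have "hs_norm (b n * a n) \<le> C * hs_norm (a n)" for n
    by (rule order_trans[OF hs_norm_mult_left[OF cb ca]]) (intro mult_right_mono C hs_norm_nonneg[OF ca])
  then show "b \<otimes>\<^bsub>bounded_seqs k\<^esub> a \<in> null_seqs k F" unfolding bounded_seqs_simps(2-)
    by (rule null_seqs_dominatedI[OF bounded_seqs_mult[OF b car[OF a]] _ l0])
  have "hs_norm (a n * b n) \<le> C * hs_norm (a n)" for n
    by (rule order_trans[OF hs_norm_mult_right[OF ca cb]], subst mult.commute)
      (intro mult_right_mono C hs_norm_nonneg[OF ca])
  then show "a \<otimes>\<^bsub>bounded_seqs k\<^esub> b \<in> null_seqs k F" unfolding bounded_seqs_simps(2-)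
    by (rule null_seqs_dominatedI[OF bounded_seqs_mult[OF car[OF a] b] _ l0])
qed

text \<open>With this identification every fact about the quotient is proved once, for a general
  filter.\<close>

lemma MHS_eq_metric_ultraproduct: "MHS k = metric_ultraproduct k sequentially"
  by (simp add: MHS_def metric_ultraproduct_def)

lemma ring_metric_ultraproduct: "ring (metric_ultraproduct k F)"
  unfolding metric_ultraproduct_def by (rule ideal.quotient_is_ring[OF ideal_null_seqs])

lemma mem_seq_class_iff:
  assumes a: "a \<in> carrier (bounded_seqs k)" and b: "b \<in> carrier (bounded_seqs k)"
  shows "a \<in> seq_class k F b \<longleftrightarrow> ((\<lambda>n. hs_norm (a n - b n)) \<longlongrightarrow> 0) F"
proof
  assume "a \<in> seq_class k F b"
  then obtain h where h: "h \<in> null_seqs k F" "a = (\<lambda>n. h n + b n)"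
    by (auto simp: seq_class_def a_r_coset_def r_coset_def bounded_seqs_simps)
  have "a n - b n = h n" for n
    unfolding h(2) by (rule eq_matI)
      (use h(1) bounded_seqs_carrier_mat[of h k n] bounded_seqs_carrier_mat[OF b, of n] in \<open>auto simp: null_seqs_def\<close>)
  then show "((\<lambda>n. hs_norm (a n - b n)) \<longlongrightarrow> 0) F" using h(1) by (simp add: null_seqs_def)
next
  assume "((\<lambda>n. hs_norm (a n - b n)) \<longlongrightarrow> 0) F"
  then have "(\<lambda>n. a n - b n) \<in> null_seqs k F" using bounded_seqs_minus[OF a b] by (simp add: null_seqs_def)
  moreover have "(\<lambda>n. (a n - b n) + b n) = a"
  proof
    show "(a n - b n) + b n = a n" for n
      by (rule eq_matI)
        (use bounded_seqs_carrier_mat[OF a, of n] bounded_seqs_carrier_mat[OF b, of n] in auto)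
  qed
  ultimately show "a \<in> seq_class k F b"
    unfolding seq_class_def a_r_coset_def r_coset_def
    by (intro UN_I[of "\<lambda>n. a n - b n"]) (simp_all add: bounded_seqs_simps)
qed

lemma seq_class_self: "a \<in> carrier (bounded_seqs k) \<Longrightarrow> a \<in> seq_class k F a"
  unfolding seq_class_def
  by (rule abelian_subgroup.a_rcos_self[OF ideal.axioms(1)[THEN abelian_subgroupI3]])
    (auto intro: ideal_null_seqs ring.is_abelian_group ring_bounded_seqs)

lemma seq_class_subset:
  "a \<in> carrier (bounded_seqs k) \<Longrightarrow> seq_class k F a \<subseteq> carrier (bounded_seqs k)"
  by (auto simp: seq_class_def a_r_coset_def r_coset_def bounded_seqs_simps(5) null_seqs_def
      bounded_seqs_add)

lemma seq_class_eq_iff: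
  assumes a: "a \<in> carrier (bounded_seqs k)" and b: "b \<in> carrier (bounded_seqs k)"
  shows "seq_class k F a = seq_class k F b \<longleftrightarrow> ((\<lambda>n. hs_norm (a n - b n)) \<longlongrightarrow> 0) F"
proof -
  interpret ideal "null_seqs k F" "bounded_seqs k" by (rule ideal_null_seqs)
  have "seq_class k F a = seq_class k F b \<longleftrightarrow> a \<in> seq_class k F b"
    using seq_class_self[OF a, of F] a_repr_independence'[of a b] b unfolding seq_class_def by metis
  then show ?thesis using mem_seq_class_iff[OF a b] by simp
qed

lemma seq_class_carrier:
  "A \<in> carrier (metric_ultraproduct k F) \<longleftrightarrow> (\<exists>a\<in>carrier (bounded_seqs k). A = seq_class k F a)"
  by (auto simp: metric_ultraproduct_def FactRing_def A_RCOSETS_defs seq_class_def a_r_coset_def)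

lemma seq_class_in_MHS: "a \<in> carrier (bounded_seqs m) \<Longrightarrow> seq_class m sequentially a \<in> carrier (MHS m)"
  unfolding MHS_eq_metric_ultraproduct seq_class_carrier by blast

lemma seq_class_hom: "seq_class k F \<in> Ring.ring_hom (bounded_seqs k) (metric_ultraproduct k F)"
  using ideal.rcos_ring_hom[OF ideal_null_seqs]
  unfolding metric_ultraproduct_def seq_class_def[abs_def] .

lemma seq_class_ops:
  assumes "a \<in> carrier (bounded_seqs k)" "b \<in> carrier (bounded_seqs k)"
  shows "seq_class k F a \<otimes>\<^bsub>metric_ultraproduct k F\<^esub> seq_class k F b = seq_class k F (\<lambda>n. a n * b n)"
    "seq_class k F a \<oplus>\<^bsub>metric_ultraproduct k F\<^esub> seq_class k F b = seq_class k F (\<lambda>n. a n + b n)"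
  using Ring.ring_hom_mult[OF seq_class_hom assms] Ring.ring_hom_add[OF seq_class_hom assms]
  by (simp_all add: bounded_seqs_simps)

lemma seq_class_one: "\<one>\<^bsub>metric_ultraproduct k F\<^esub> = seq_class k F (\<lambda>n. 1\<^sub>m (k n))"
  using Ring.ring_hom_one[OF seq_class_hom] by (simp add: bounded_seqs_simps)

section \<open>Central idempotents\<close>

definition proj_seq :: "(nat \<Rightarrow> nat) \<Rightarrow> nat set \<Rightarrow> nat \<Rightarrow> complex mat" where
  "proj_seq k S n = (if n \<in> S then 1\<^sub>m (k n) else 0\<^sub>m (k n) (k n))"

lemma proj_seq_mat: "proj_seq k S n \<in> carrier_mat (k n) (k n)"
  by (simp add: proj_seq_def)

lemma proj_seq_carrier: "proj_seq k S \<in> carrier (bounded_seqs k)"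
  by (rule bounded_seqs_memI[of _ _ 1]) (auto simp: proj_seq_def op_norm_one op_norm_zero)

lemma proj_seq_mult:
  "A \<in> carrier_mat (k n) (k n) \<Longrightarrow> proj_seq k S n * A = (if n \<in> S then A else 0\<^sub>m (k n) (k n))"
  "A \<in> carrier_mat (k n) (k n) \<Longrightarrow> A * proj_seq k S n = (if n \<in> S then A else 0\<^sub>m (k n) (k n))"
  by (simp_all add: proj_seq_def)

text \<open>Restricting the filter to S amounts to cutting the sequence off outside S, and that is
  the effect of multiplying matrices by \<open>proj_seq\<close>.\<close>

lemma tendsto_on_iff:
  fixes f :: "nat \<Rightarrow> real"
  shows "(f \<longlongrightarrow> 0) (inf sequentially (principal S)) \<longleftrightarrow> (\<lambda>n. if n \<in> S then f n else 0) \<longlonglongrightarrow> 0"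
  unfolding tendsto_iff eventually_inf_principal
  by (intro all_cong1 imp_cong refl eventually_cong always_eventually allI) auto

lemma tendsto_indicator_iff:
  "(\<lambda>n. if n \<in> S then 1 else (0::real)) \<longlonglongrightarrow> 0 \<longleftrightarrow> finite S"
proof
  assume "(\<lambda>n. if n \<in> S then 1 else (0::real)) \<longlonglongrightarrow> 0"
  then have "\<forall>\<^sub>F n in sequentially. dist (if n \<in> S then 1 else (0::real)) 0 < 1"
    by (rule tendstoD) simp
  then have "\<forall>\<^sub>F n in sequentially. n \<notin> S" by eventually_elim (auto split: if_splits)
  then show "finite S" by (simp add: cofinite_eq_sequentially[symmetric] eventually_cofinite)
next
  assume "finite S"
  then have "\<forall>\<^sub>F n in sequentially. n \<notin> S"
    by (simp add: cofinite_eq_sequentially[symmetric] eventually_cofinite)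
  then show "(\<lambda>n. if n \<in> S then 1 else (0::real)) \<longlonglongrightarrow> 0"
    by (intro tendsto_eventually) (auto elim: eventually_mono)
qed

text \<open>The two projections differ by norm exactly 1 on the symmetric difference, since the
  identity of positive size has norm 1. Thus sets modulo finite sets embed into
  \<open>MHS k\<close>.\<close>

lemma proj_class_eq_iff:
  assumes "\<forall>n. 0 < k n"
  shows "seq_class k sequentially (proj_seq k S) = seq_class k sequentially (proj_seq k T)
    \<longleftrightarrow> finite ((S - T) \<union> (T - S))"
proof -
  have "hs_norm (proj_seq k S n - proj_seq k T n) = (if n \<in> (S - T) \<union> (T - S) then 1 else 0)" for n
  proof -
    have s: "A - A = 0\<^sub>m (k n) (k n)" "A - 0\<^sub>m (k n) (k n) = A" if "A \<in> carrier_mat (k n) (k n)"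
      for A :: "complex mat" using that by (auto intro: eq_matI)
    show ?thesis using assms hs_norm_minus_commute[of "0\<^sub>m (k n) (k n)" "k n" "1\<^sub>m (k n)"]
      by (auto simp: proj_seq_def hs_norm_one hs_norm_zero s)
  qed
  then show ?thesis by (simp only: seq_class_eq_iff[OF proj_seq_carrier proj_seq_carrier] tendsto_indicator_iff)
qed

lemma proj_class_mult:
  "seq_class k F (proj_seq k S) \<otimes>\<^bsub>metric_ultraproduct k F\<^esub> seq_class k F (proj_seq k T)
    = seq_class k F (proj_seq k (S \<inter> T))"
proof -
  have "(\<lambda>n. proj_seq k S n * proj_seq k T n) = proj_seq k (S \<inter> T)"
    by (rule ext) (simp add: proj_seq_mult proj_seq_mat, simp add: proj_seq_def)
  then show ?thesis by (simp add: seq_class_ops proj_seq_carrier)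
qed

lemma proj_class_central:
  assumes "A \<in> carrier (metric_ultraproduct k F)"
  shows "seq_class k F (proj_seq k S) \<otimes>\<^bsub>metric_ultraproduct k F\<^esub> A = A \<otimes>\<^bsub>metric_ultraproduct k F\<^esub> seq_class k F (proj_seq k S)"
proof -
  obtain a where a: "a \<in> carrier (bounded_seqs k)" "A = seq_class k F a"
    using assms seq_class_carrier by blast
  then show ?thesis
    by (simp add: seq_class_ops proj_seq_carrier proj_seq_mult bounded_seqs_carrier_mat)
qed

text \<open>Stated in ring terms only: an isomorphism that is not assumed to respect adjoints or
  norms still preserves it.\<close>

definition central_idempotent :: "('a, 'b) ring_scheme \<Rightarrow> 'a \<Rightarrow> bool" where
  "central_idempotent R e \<longleftrightarrow> e \<in> carrier R \<and> e \<otimes>\<^bsub>R\<^esub> e = e \<and> (\<forall>x\<in>carrier R. e \<otimes>\<^bsub>R\<^esub> x = x \<otimes>\<^bsub>R\<^esub> e)"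

lemma central_idempotent_ring_iso:
  assumes h: "h \<in> ring_iso R S" and e: "central_idempotent R e"
  shows "central_idempotent S (h e)"
  unfolding central_idempotent_def
proof (intro conjI ballI)
  have car: "e \<in> carrier R" using e by (simp add: central_idempotent_def)
  show "h e \<in> carrier S" using ring_iso_memE(1)[OF h car] .
  show "h e \<otimes>\<^bsub>S\<^esub> h e = h e"
    using ring_iso_memE(2)[OF h car car] e by (simp add: central_idempotent_def)
  fix y assume "y \<in> carrier S"
  then obtain x where x: "x \<in> carrier R" "y = h x"
    using ring_iso_memE(5)[OF h] by (auto simp: bij_betw_def)
  then show "h e \<otimes>\<^bsub>S\<^esub> y = y \<otimes>\<^bsub>S\<^esub> h e"
    using ring_iso_memE(2)[OF h car x(1)] ring_iso_memE(2)[OF h x(1) car] e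
    by (simp add: central_idempotent_def)
qed

lemma central_idempotent_proj_class:
  "central_idempotent (metric_ultraproduct k F) (seq_class k F (proj_seq k S))"
  unfolding central_idempotent_def
  using proj_seq_carrier proj_class_central by (auto simp: seq_class_carrier proj_class_mult)

text \<open>Centrality gives vanishing commutators with every bounded sequence, in particular with
  one whose n-th matrix is chosen to detect the distance of the n-th representative to the scalars.
  So a central element is asymptotically scalar, and idempotence pushes the scalars to 0 or
  1.\<close>

lemma central_idempotent_MHS:
  assumes k: "\<forall>n. 0 < k n" and A: "central_idempotent (MHS k) A"
  shows "\<exists>S. A = seq_class k sequentially (proj_seq k S)"
proof -
  let ?M = "metric_ultraproduct k sequentially"
  note cm = bounded_seqs_carrier_mat
  have M: "A \<in> carrier ?M" "A \<otimes>\<^bsub>?M\<^esub> A = A"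
    and cent: "\<And>x. x \<in> carrier ?M \<Longrightarrow> A \<otimes>\<^bsub>?M\<^esub> x = x \<otimes>\<^bsub>?M\<^esub> A"
    using A unfolding central_idempotent_def MHS_eq_metric_ultraproduct by simp_all
  from M(1) obtain a where a: "a \<in> carrier (bounded_seqs k)" and Aa: "A = seq_class k sequentially a"
    unfolding seq_class_carrier by (elim bexE)
  have idem: "(\<lambda>n. hs_norm (a n * a n - a n)) \<longlonglongrightarrow> 0"
    using M(2) unfolding Aa seq_class_ops[OF a a] seq_class_eq_iff[OF bounded_seqs_mult[OF a a] a] .
  have comm: "(\<lambda>n. hs_norm (a n * w n - w n * a n)) \<longlonglongrightarrow> 0" if "w \<in> carrier (bounded_seqs k)" for w
  proof -
    have "seq_class k sequentially w \<in> carrier ?M"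
      unfolding seq_class_carrier by (rule bexI[OF refl that])
    from cent[OF this] show ?thesis
      unfolding Aa seq_class_ops[OF a that] seq_class_ops[OF that a]
        seq_class_eq_iff[OF bounded_seqs_mult[OF a that] bounded_seqs_mult[OF that a]] .
  qed
  obtain C where C: "\<And>n. op_norm (a n) \<le> C" using a by (auto simp: bounded_seqs_simps)
  have "\<forall>n. \<exists>c V W. V \<in> carrier_mat (k n) (k n) \<and> W \<in> carrier_mat (k n) (k n) \<and> op_norm V \<le> 1 \<and> op_norm W \<le> 1 \<and>
    (hs_norm (a n - c \<cdot>\<^sub>m 1\<^sub>m (k n)))\<^sup>2 \<le> 2 * (hs_norm (a n * V - V * a n))\<^sup>2 + (hs_norm (a n * W - W * a n))\<^sup>2"
    using dist_scalar_le_commutators[OF cm[OF a]] k by blast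
  then obtain c V W where VW: "\<And>n. V n \<in> carrier_mat (k n) (k n)" "\<And>n. W n \<in> carrier_mat (k n) (k n)"
    "\<And>n. op_norm (V n) \<le> 1" "\<And>n. op_norm (W n) \<le> 1" and
    le: "\<And>n. (hs_norm (a n - c n \<cdot>\<^sub>m 1\<^sub>m (k n)))\<^sup>2
      \<le> 2 * (hs_norm (a n * V n - V n * a n))\<^sup>2 + (hs_norm (a n * W n - W n * a n))\<^sup>2"
    by metis
  \<comment> \<open>The contractions chosen separately for each n form bounded sequences, so
    centrality applies to them.\<close>
  have V: "V \<in> carrier (bounded_seqs k)" and W: "W \<in> carrier (bounded_seqs k)"
    using VW by (auto intro: bounded_seqs_memI[of _ _ 1])
  define e where "e n = sqrt (2 * (hs_norm (a n * V n - V n * a n))\<^sup>2 + (hs_norm (a n * W n - W n * a n))\<^sup>2)" for n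
  have "e \<longlonglongrightarrow> sqrt (2 * 0\<^sup>2 + 0\<^sup>2)"
    unfolding e_def by (intro tendsto_intros comm V W)
  then have e: "e \<longlonglongrightarrow> 0" by simp
  have ce: "hs_norm (a n - c n \<cdot>\<^sub>m 1\<^sub>m (k n)) \<le> e n" for n
    unfolding e_def using le[of n] by (rule real_le_rsqrt)
  \<comment> \<open>S collects the indices at which the representative is at least as close to 1 as
    to 0, so its distance to the projection of S is the minimum of both distances.\<close>
  define S where "S = {n. hs_norm (a n - 1\<^sub>m (k n)) \<le> hs_norm (a n)}"
  have "hs_norm (a n - proj_seq k S n) = min (hs_norm (a n)) (hs_norm (a n - 1\<^sub>m (k n)))" for n
  proof -
    have "a n - 0\<^sub>m (k n) (k n) = a n" using cm[OF a, of n] by (auto intro: eq_matI)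
    then show ?thesis by (auto simp: proj_seq_def S_def)
  qed
  then have "hs_norm (a n - proj_seq k S n)
      \<le> e n + 2 * (hs_norm (a n * a n - a n) + e n * (2 * C + 1 + e n))" for n
    using near_idempotent_scalar[OF cm[OF a] _ C ce, of n] k by simp
  moreover have "(\<lambda>n. e n + 2 * (hs_norm (a n * a n - a n) + e n * (2 * C + 1 + e n)))
      \<longlonglongrightarrow> 0 + 2 * (0 + 0 * (2 * C + 1 + 0))"
    by (intro tendsto_intros idem e)
  ultimately have "(\<lambda>n. a n - proj_seq k S n) \<in> null_seqs k sequentially"
    by (intro null_seqs_dominatedI[OF bounded_seqs_minus[OF a proj_seq_carrier]]) auto
  then show ?thesis
    unfolding Aa using seq_class_eq_iff[OF a proj_seq_carrier] by (auto simp: null_seqs_def)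
qed

section \<open>Equality along a set, in terms of projections\<close>

lemma proj_eq_along_iff:
  assumes "\<forall>n. 0 < m n"
  shows "((\<lambda>n. hs_norm (proj_seq m X n - proj_seq m {} n)) \<longlongrightarrow> 0) (inf sequentially (principal T)) \<longleftrightarrow> finite (X \<inter> T)"
proof -
  have "hs_norm (proj_seq m X n - proj_seq m {} n) = (if n \<in> X then 1 else 0)" for n
  proof -
    have "A - 0\<^sub>m (m n) (m n) = A" if "A \<in> carrier_mat (m n) (m n)" for A :: "complex mat"
      using that by (auto intro: eq_matI)
    then show ?thesis using assms by (simp add: proj_seq_def hs_norm_one hs_norm_zero)
  qed
  moreover have "(\<lambda>n. if n \<in> T then if n \<in> X then 1 else 0 else (0::real)) = (\<lambda>n. if n \<in> X \<inter> T then 1 else 0)"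
    by auto
  ultimately show ?thesis by (simp only: tendsto_on_iff tendsto_indicator_iff)
qed

text \<open>\<open>eq_on\<close> quantifies over all representatives, but one choice decides: null
  sequences change the distances by terms tending to zero, and a finite change of S does not affect
  the restriction of \<open>sequentially\<close>.\<close>

lemma eq_on_class_iff:
  assumes a: "a \<in> carrier (bounded_seqs k)" and b: "b \<in> carrier (bounded_seqs k)"
  shows "eq_on (fin_equiv `` {S}) (seq_class k sequentially a) (seq_class k sequentially b)
    \<longleftrightarrow> ((\<lambda>n. hs_norm (a n - b n)) \<longlongrightarrow> 0) (inf sequentially (principal S))"
proof
  assume "eq_on (fin_equiv `` {S}) (seq_class k sequentially a) (seq_class k sequentially b)"
  moreover have "S \<in> fin_equiv `` {S}" by (simp add: fin_equiv_def)
  ultimately show "((\<lambda>n. hs_norm (a n - b n)) \<longlongrightarrow> 0) (inf sequentially (principal S))"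
    using seq_class_self[OF a] seq_class_self[OF b] unfolding eq_on_def by blast
next
  assume lim: "((\<lambda>n. hs_norm (a n - b n)) \<longlongrightarrow> 0) (inf sequentially (principal S))"
  show "eq_on (fin_equiv `` {S}) (seq_class k sequentially a) (seq_class k sequentially b)"
    unfolding eq_on_def
  proof (intro ballI)
    fix a' b' T
    assume a': "a' \<in> seq_class k sequentially a" and b': "b' \<in> seq_class k sequentially b"
      and T: "T \<in> fin_equiv `` {S}"
    note ca' = subsetD[OF seq_class_subset[OF a] a'] and cb' = subsetD[OF seq_class_subset[OF b] b']
    note cm = bounded_seqs_carrier_mat[OF a] bounded_seqs_carrier_mat[OF b]
      bounded_seqs_carrier_mat[OF ca'] bounded_seqs_carrier_mat[OF cb']
    have "finite (T - S)" using T by (simp add: fin_equiv_def)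
    then have "\<forall>\<^sub>F n in sequentially. n \<notin> T - S"
      by (simp add: cofinite_eq_sequentially[symmetric] eventually_cofinite set_diff_eq)
    then have "\<forall>\<^sub>F n in inf sequentially (principal T). n \<in> S"
      unfolding eventually_inf_principal by eventually_elim blast
    then have le: "inf sequentially (principal T) \<le> inf sequentially (principal S)"
      by (simp add: le_principal)
    have "((\<lambda>n. hs_norm (a' n - a n) + (hs_norm (a n - b n) + hs_norm (b' n - b n))) \<longlongrightarrow> 0 + (0 + 0))
        (inf sequentially (principal T))"
    proof (intro tendsto_add)
      show "((\<lambda>n. hs_norm (a' n - a n)) \<longlongrightarrow> 0) (inf sequentially (principal T))"
        using mem_seq_class_iff[OF ca' a] a' by (auto intro: tendsto_mono[OF inf.cobounded1])
      show "((\<lambda>n. hs_norm (b' n - b n)) \<longlongrightarrow> 0) (inf sequentially (principal T))"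
        using mem_seq_class_iff[OF cb' b] b' by (auto intro: tendsto_mono[OF inf.cobounded1])
      show "((\<lambda>n. hs_norm (a n - b n)) \<longlongrightarrow> 0) (inf sequentially (principal T))"
        by (rule tendsto_mono[OF le lim])
    qed
    moreover have "hs_norm (a' n - b' n) \<le> hs_norm (a' n - a n) + (hs_norm (a n - b n) + hs_norm (b' n - b n))" for n
      using hs_norm_diff_triangle[OF cm(3,1,4), of n] hs_norm_diff_triangle[OF cm(1,2,4), of n]
        hs_norm_minus_commute[OF cm(2,4), of n] by linarith
    ultimately have "(\<lambda>n. a' n - b' n) \<in> null_seqs k (inf sequentially (principal T))"
      by (intro null_seqs_dominatedI[OF bounded_seqs_minus[OF ca' cb']]) auto
    then show "((\<lambda>n. hs_norm (a' n - b' n)) \<longlongrightarrow> 0) (inf sequentially (principal T))"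
      by (simp add: null_seqs_def)
  qed
qed

text \<open>The analytic relation becomes an equation between ring elements, a form in which a ring
  isomorphism can transport it.\<close>

lemma eq_along_iff_proj_mult:
  assumes a: "a \<in> carrier (bounded_seqs k)" and b: "b \<in> carrier (bounded_seqs k)"
  shows "((\<lambda>n. hs_norm (a n - b n)) \<longlongrightarrow> 0) (inf sequentially (principal S)) \<longleftrightarrow>
    seq_class k sequentially (proj_seq k S) \<otimes>\<^bsub>MHS k\<^esub> seq_class k sequentially a
      = seq_class k sequentially (proj_seq k S) \<otimes>\<^bsub>MHS k\<^esub> seq_class k sequentially b"
proof -
  have "hs_norm (proj_seq k S n * a n - proj_seq k S n * b n) = (if n \<in> S then hs_norm (a n - b n) else 0)" for n
  proof -
    have "0\<^sub>m (k n) (k n) - 0\<^sub>m (k n) (k n) = (0\<^sub>m (k n) (k n) :: complex mat)" by (auto intro: eq_matI)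
    then have "hs_norm (0\<^sub>m (k n) (k n) - 0\<^sub>m (k n) (k n)) = 0" by (simp only: hs_norm_zero)
    then show ?thesis
      by (simp add: proj_seq_mult bounded_seqs_carrier_mat[OF a] bounded_seqs_carrier_mat[OF b])
  qed
  then show ?thesis
    by (simp add: MHS_eq_metric_ultraproduct seq_class_ops seq_class_eq_iff proj_seq_carrier
        bounded_seqs_mult a b tendsto_on_iff)
qed

section \<open>Duality for automorphisms modulo finite sets\<close>

text \<open>The graph of an automorphism of the Boolean algebra of sets modulo finite sets, as a relation
  between representatives.\<close>

definition mod_fin_iso :: "(nat set \<Rightarrow> nat set \<Rightarrow> bool) \<Rightarrow> bool" where
  "mod_fin_iso E \<longleftrightarrow> (\<forall>S. \<exists>R. E S R) \<and> (\<forall>R. \<exists>S. E S R) \<and>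
     (\<forall>S R S' R'. E S R \<longrightarrow> E S' R' \<longrightarrow> (finite (S - S') \<longleftrightarrow> finite (R - R')))"

lemma mod_fin_iso_conversep: "mod_fin_iso E \<Longrightarrow> mod_fin_iso E\<inverse>\<inverse>"
  unfolding mod_fin_iso_def conversep_iff by blast

context
  fixes E assumes E: "mod_fin_iso E"
begin

lemma mod_fin_iso_total: "\<exists>R. E S R" and mod_fin_iso_onto: "\<exists>S. E S R"
  using E by (auto simp: mod_fin_iso_def)

lemma mod_fin_iso_diff: "E S R \<Longrightarrow> E S' R' \<Longrightarrow> finite (S - S') \<longleftrightarrow> finite (R - R')"
  using E by (auto simp: mod_fin_iso_def)

lemma mod_fin_iso_mono:
  assumes "E S R" "E S' R'"
  shows "S \<subseteq> S' \<Longrightarrow> finite (R - R')" "R \<subseteq> R' \<Longrightarrow> finite (S - S')"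
  using mod_fin_iso_diff[OF assms] by (simp_all only: Diff_eq_empty_iff[THEN iffD2] finite.emptyI)

text \<open>Finite means almost contained in the empty set, and the empty set has a partner on
  either side to compare with.\<close>

lemma mod_fin_iso_finite:
  assumes "E S R" shows "finite S \<longleftrightarrow> finite R"
proof -
  obtain R0 where R0: "E {} R0" using mod_fin_iso_total by blast
  obtain S0 where S0: "E S0 {}" using mod_fin_iso_onto by blast
  have "finite S0" if "finite S" using mod_fin_iso_diff[OF S0 assms] by (simp add: that finite_Diff2)
  then show ?thesis
    using mod_fin_iso_diff[OF assms R0] mod_fin_iso_diff[OF assms S0] by (auto dest: finite_Diff2)
qed

text \<open>An order isomorphism respects meets: a partner Y of the intersection on the right is
  almost below S and S', hence almost below their intersection. This inclusion is the one needed for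
  closure of the dual filter under conjunction.\<close>

lemma mod_fin_iso_Int:
  assumes "E S R" "E S' R'" "E (S \<inter> S') R''"
  shows "finite (R \<inter> R' - R'')"
proof -
  obtain Y where Y: "E Y (R \<inter> R')" using mod_fin_iso_onto by blast
  have "finite (Y - S)" "finite (Y - S')"
    by (rule mod_fin_iso_mono[OF Y assms(1)], blast) (rule mod_fin_iso_mono[OF Y assms(2)], blast)
  then have "finite ((Y - S) \<union> (Y - S'))" by simp
  then have "finite (Y - S \<inter> S')" by (rule rev_finite_subset) auto
  then show ?thesis using mod_fin_iso_diff[OF Y assms(3)] by simp
qed

text \<open>A partner Y of what is left uncovered meets S and its complement only in finite sets: a
  partner of such an intersection is almost contained in two disjoint sets. So Y is finite. The
  inclusion yields the ultrafilter property of the dual filter.\<close>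

lemma mod_fin_iso_Compl:
  assumes "E S R" "E (- S) R'"
  shows "finite (- R - R')"
proof -
  obtain Y where Y: "E Y (- R - R')" using mod_fin_iso_onto by blast
  have fin: "finite (Y \<inter> Z)" if Z: "E Z W" "W = R \<or> W = R'" for Z W
  proof -
    obtain V where V: "E (Y \<inter> Z) V" using mod_fin_iso_total by blast
    have "finite (V - (- R - R'))" "finite (V - W)"
      by (rule mod_fin_iso_mono[OF V Y], blast) (rule mod_fin_iso_mono[OF V Z(1)], blast)
    then have "finite ((V - (- R - R')) \<union> (V - W))" by simp
    then have "finite V" by (rule rev_finite_subset) (use Z(2) in auto)
    then show ?thesis using mod_fin_iso_finite[OF V] by simp
  qed
  have "finite ((Y \<inter> S) \<union> (Y \<inter> - S))" using fin[OF assms(1)] fin[OF assms(2)] by blast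
  then have "finite Y" by (rule rev_finite_subset) auto
  then show ?thesis using mod_fin_iso_finite[OF Y] by simp
qed

section \<open>The homeomorphism dual to an automorphism\<close>

definition dual_filter :: "nat filter \<Rightarrow> nat filter" where
  "dual_filter U = Abs_filter (\<lambda>P. \<exists>R. E {n. P n} R \<and> (\<forall>\<^sub>F n in U. n \<in> R))"

lemma eventually_mono_mod_fin:
  assumes "U \<in> nonprincipal_ultrafilters" "finite (S - T)" "\<forall>\<^sub>F n in U. n \<in> S"
  shows "\<forall>\<^sub>F n in U. n \<in> T"
  using assms nonprincipal_le_iff_finite by blast

text \<open>This is where the filter axioms for the formula \<theta>(U) = {S. \<theta>(S) in U} are
  checked, with partners under E in place of \<theta>(S). Partners are determined only up to finite
  sets, which a nonprincipal U ignores.\<close>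

lemma eventually_dual_filter:
  assumes U: "U \<in> nonprincipal_ultrafilters"
  shows "eventually P (dual_filter U) \<longleftrightarrow> (\<exists>R. E {n. P n} R \<and> (\<forall>\<^sub>F n in U. n \<in> R))"
  unfolding dual_filter_def
proof (rule eventually_Abs_filter, rule is_filter.intro)
  obtain R where R: "E UNIV R" using mod_fin_iso_total by blast
  \<comment> \<open>Comparing a set paired with \<open>UNIV\<close> on the right with the partner R
    of \<open>UNIV\<close> shows that R is cofinite.\<close>
  obtain S where S: "E S UNIV" using mod_fin_iso_onto by blast
  have "finite (UNIV - R)" using mod_fin_iso_diff[OF S R] by simp
  then have "\<forall>\<^sub>F n in U. n \<in> R" by (rule eventually_mono_mod_fin[OF U]) simp
  with R show "\<exists>R. E {n. True} R \<and> (\<forall>\<^sub>F n in U. n \<in> R)" by auto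
next
  fix P Q assume "\<exists>R. E {n. P n} R \<and> (\<forall>\<^sub>F n in U. n \<in> R)" "\<exists>R. E {n. Q n} R \<and> (\<forall>\<^sub>F n in U. n \<in> R)"
  then obtain R R' where R: "E {n. P n} R" "\<forall>\<^sub>F n in U. n \<in> R" and R': "E {n. Q n} R'" "\<forall>\<^sub>F n in U. n \<in> R'"
    by blast
  obtain R'' where R'': "E ({n. P n} \<inter> {n. Q n}) R''" using mod_fin_iso_total by blast
  have "\<forall>\<^sub>F n in U. n \<in> R \<inter> R'" using R(2) R'(2) by eventually_elim simp
  then have "\<forall>\<^sub>F n in U. n \<in> R''" by (rule eventually_mono_mod_fin[OF U mod_fin_iso_Int[OF R(1) R'(1) R'']])
  moreover have "{n. P n} \<inter> {n. Q n} = {n. P n \<and> Q n}" by blast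
  ultimately show "\<exists>R. E {n. P n \<and> Q n} R \<and> (\<forall>\<^sub>F n in U. n \<in> R)" using R'' by auto
next
  fix P Q assume PQ: "\<forall>n. P n \<longrightarrow> Q n" and "\<exists>R. E {n. P n} R \<and> (\<forall>\<^sub>F n in U. n \<in> R)"
  then obtain R where R: "E {n. P n} R" "\<forall>\<^sub>F n in U. n \<in> R" by blast
  obtain R' where R': "E {n. Q n} R'" using mod_fin_iso_total by blast
  have "finite (R - R')" by (rule mod_fin_iso_mono[OF R(1) R']) (use PQ in blast)
  then have "\<forall>\<^sub>F n in U. n \<in> R'" by (rule eventually_mono_mod_fin[OF U _ R(2)])
  with R' show "\<exists>R. E {n. Q n} R \<and> (\<forall>\<^sub>F n in U. n \<in> R)" by blast
qed

text \<open>Two partners of the same set differ by a finite set, so the existential over partners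
  may be tested on any given one.\<close>

lemma dual_filter_iff:
  assumes U: "U \<in> nonprincipal_ultrafilters" and SR: "E S R"
  shows "(\<forall>\<^sub>F n in dual_filter U. n \<in> S) \<longleftrightarrow> (\<forall>\<^sub>F n in U. n \<in> R)"
proof -
  have "\<forall>\<^sub>F n in U. n \<in> R" if "E S R'" "\<forall>\<^sub>F n in U. n \<in> R'" for R'
    by (rule eventually_mono_mod_fin[OF U _ that(2)]) (use mod_fin_iso_diff[OF that(1) SR] in simp)
  then show ?thesis using SR unfolding eventually_dual_filter[OF U] by auto
qed

lemma dual_filter_nonprincipal:
  assumes U: "U \<in> nonprincipal_ultrafilters"
  shows "dual_filter U \<in> nonprincipal_ultrafilters"
proof -
  have fin: "\<not> (\<forall>\<^sub>F n in dual_filter U. n \<in> S)" if "finite S" for S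
  proof -
    obtain R where R: "E S R" using mod_fin_iso_total by blast
    then have "finite R" using mod_fin_iso_finite that by blast
    then show ?thesis using dual_filter_iff[OF U R] nonprincipal_infinite[OF U] by blast
  qed
  have "dual_filter U \<noteq> bot" using fin[of "{}"] by auto
  moreover have "dual_filter U \<noteq> principal {n}" for n
    using fin[of "{n}"] by (auto simp: eventually_principal)
  moreover have "eventually P (dual_filter U) \<or> (\<forall>\<^sub>F n in dual_filter U. \<not> P n)" for P
  proof -
    obtain R where R: "E {n. P n} R" using mod_fin_iso_total by blast
    obtain R' where R': "E (- {n. P n}) R'" using mod_fin_iso_total by blast
    have "(\<forall>\<^sub>F n in U. n \<in> R) \<or> (\<forall>\<^sub>F n in U. n \<in> R')"
    proof (cases "\<forall>\<^sub>F n in U. n \<in> R")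
      case False
      then have "\<forall>\<^sub>F n in U. n \<in> - R" using nonprincipal_not[OF U, of "\<lambda>n. n \<in> R"] by simp
      then show ?thesis using eventually_mono_mod_fin[OF U mod_fin_iso_Compl[OF R R']] by blast
    qed simp
    then show ?thesis using dual_filter_iff[OF U R] dual_filter_iff[OF U R'] by simp
  qed
  ultimately show ?thesis by (simp add: nonprincipal_ultrafilters_def)
qed

text \<open>The preimage of the basic open set given by S is the basic open set given by a partner
  of S.\<close>

lemma continuous_dual_filter:
  "continuous_map boundary_topology boundary_topology (restrict dual_filter nonprincipal_ultrafilters)"
  unfolding boundary_topology_def
proof (rule continuous_on_generated_topo)
  fix W assume "W \<in> {{U \<in> nonprincipal_ultrafilters. \<forall>\<^sub>F n in U. n \<in> S} |S. True}"
  then obtain S where W: "W = {U \<in> nonprincipal_ultrafilters. \<forall>\<^sub>F n in U. n \<in> S}" by blast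
  obtain R where R: "E S R" using mod_fin_iso_total by blast
  have "restrict dual_filter nonprincipal_ultrafilters -` W \<inter> nonprincipal_ultrafilters
      = {U \<in> nonprincipal_ultrafilters. \<forall>\<^sub>F n in U. n \<in> R}"
    using dual_filter_nonprincipal dual_filter_iff[OF _ R] by (auto simp: W)
  moreover have "openin boundary_topology {U \<in> nonprincipal_ultrafilters. \<forall>\<^sub>F n in U. n \<in> R}"
    unfolding boundary_topology_def by (rule topology_generated_by_Basis) blast
  ultimately show "openin (topology_generated_by {{U \<in> nonprincipal_ultrafilters. \<forall>\<^sub>F n in U. n \<in> S} |S. True})
      (restrict dual_filter nonprincipal_ultrafilters -` W \<inter> topspace (topology_generated_by {{U \<in> nonprincipal_ultrafilters. \<forall>\<^sub>F n in U. n \<in> S} |S. True}))"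
    using topspace_boundary by (simp add: boundary_topology_def)
next
  have "topspace boundary_topology = nonprincipal_ultrafilters" by (rule topspace_boundary)
  moreover have "\<Union> {{U \<in> nonprincipal_ultrafilters. \<forall>\<^sub>F n in U. n \<in> S} |S. True} = nonprincipal_ultrafilters"
    using topspace_boundary unfolding boundary_topology_def topology_generated_by_topspace .
  ultimately show "restrict dual_filter nonprincipal_ultrafilters ` topspace (topology_generated_by {{U \<in> nonprincipal_ultrafilters. \<forall>\<^sub>F n in U. n \<in> S} |S. True})
      \<subseteq> \<Union> {{U \<in> nonprincipal_ultrafilters. \<forall>\<^sub>F n in U. n \<in> S} |S. True}"
    using dual_filter_nonprincipal by (auto simp: boundary_topology_def)
qed

end

lemma dual_filter_converse:
  assumes E: "mod_fin_iso E" and U: "U \<in> nonprincipal_ultrafilters"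
  shows "dual_filter E (dual_filter E\<inverse>\<inverse> U) = U"
proof -
  note E' = mod_fin_iso_conversep[OF E]
  note U' = dual_filter_nonprincipal[OF E' U]
  have "eventually P (dual_filter E (dual_filter E\<inverse>\<inverse> U)) \<longleftrightarrow> eventually P U" for P
  proof -
    obtain R where R: "E {n. P n} R" using mod_fin_iso_total[OF E] by blast
    then have "E\<inverse>\<inverse> R {n. P n}" by simp
    from dual_filter_iff[OF E' U this] dual_filter_iff[OF E U' R] show ?thesis
      by (simp only: mem_Collect_eq)
  qed
  then show ?thesis by (simp add: filter_eq_iff)
qed

text \<open>The inverse is the dual map of the converse relation, which satisfies the same
  hypotheses; its continuity therefore comes from the same lemma.\<close>

lemma dual_filter_homeo:
  assumes E: "mod_fin_iso E"
  shows "restrict (dual_filter E) nonprincipal_ultrafilters \<in> boundary_homeos"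
proof -
  note E' = mod_fin_iso_conversep[OF E]
  have "homeomorphic_maps boundary_topology boundary_topology
      (restrict (dual_filter E) nonprincipal_ultrafilters) (restrict (dual_filter E\<inverse>\<inverse>) nonprincipal_ultrafilters)"
    unfolding homeomorphic_maps_def topspace_boundary
    using continuous_dual_filter[OF E] continuous_dual_filter[OF E']
      dual_filter_converse[OF E] dual_filter_converse[OF E']
      dual_filter_nonprincipal[OF E] dual_filter_nonprincipal[OF E'] by simp
  then show ?thesis
    unfolding boundary_homeos_def using homeomorphic_maps_map by auto
qed

section \<open>Stone duals evaluated on representatives\<close>

lemma boundary_homeos_nonprincipal:
  assumes "\<theta> \<in> boundary_homeos" "U \<in> nonprincipal_ultrafilters"
  shows "\<theta> U \<in> nonprincipal_ultrafilters"
proof -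
  have "continuous_map boundary_topology boundary_topology \<theta>"
    using assms(1) by (auto simp: boundary_homeos_def homeomorphic_imp_continuous_map)
  then show ?thesis using assms(2) by (auto simp: continuous_map_def topspace_boundary)
qed

lemma fin_equiv_class_in_P_mod_Fin: "fin_equiv `` {S} \<in> P_mod_Fin"
  by (simp add: P_mod_Fin_def quotientI)

lemma stone_dual_eqI:
  assumes "\<theta> \<in> boundary_homeos"
    and "\<And>U. U \<in> nonprincipal_ultrafilters \<Longrightarrow> (\<forall>\<^sub>F n in \<theta> U. n \<in> S) \<longleftrightarrow> (\<forall>\<^sub>F n in U. n \<in> R)"
  shows "stone_dual \<theta> (fin_equiv `` {S}) = fin_equiv `` {R}"
proof -
  have S: "fin_equiv `` {S} \<in> P_mod_Fin" and R: "fin_equiv `` {R} \<in> P_mod_Fin"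
    by (simp_all add: P_mod_Fin_def quotientI)
  show ?thesis unfolding stone_dual_def
    by (rule the1_equality[OF stone_dual_ex1[OF assms(1) S]])
      (use assms R boundary_homeos_nonprincipal[OF assms(1)] in \<open>simp add: class_in_image\<close>)
qed

lemma stone_dual_eventually:
  assumes \<theta>: "\<theta> \<in> boundary_homeos" and eq: "stone_dual \<theta> (fin_equiv `` {S}) = fin_equiv `` {R}"
    and U: "U \<in> nonprincipal_ultrafilters"
  shows "(\<forall>\<^sub>F n in \<theta> U. n \<in> S) \<longleftrightarrow> (\<forall>\<^sub>F n in U. n \<in> R)"
proof -
  have S: "fin_equiv `` {S} \<in> P_mod_Fin" by (simp add: P_mod_Fin_def quotientI)
  have "\<forall>U\<in>nonprincipal_ultrafilters. class_in (fin_equiv `` {S}) (\<theta> U) \<longleftrightarrow> class_in (fin_equiv `` {R}) U"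
    using theI'[OF stone_dual_ex1[OF \<theta> S]] unfolding eq[symmetric] stone_dual_def by blast
  then have "class_in (fin_equiv `` {S}) (\<theta> U) \<longleftrightarrow> class_in (fin_equiv `` {R}) U" using U by blast
  then show ?thesis by (simp only: class_in_image U boundary_homeos_nonprincipal[OF \<theta> U])
qed

text \<open>The obstacle is that f may tend to zero along V without doing so along any single set of
  V, so the hypothesis on pairs of sets cannot be applied to a member of V. It is applied to a set
  extracted diagonally from a failure of the conclusion; that set need not belong to U.\<close>

lemma tendsto_transfer:
  fixes f g :: "nat \<Rightarrow> real"
  assumes E: "mod_fin_iso E"
    and fg: "\<And>S R. E S R \<Longrightarrow> (f \<longlongrightarrow> 0) (inf sequentially (principal S)) \<Longrightarrow> (g \<longlongrightarrow> 0) (inf sequentially (principal R))"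
    and U: "U \<in> nonprincipal_ultrafilters"
    and VU: "\<And>S R. E S R \<Longrightarrow> \<forall>\<^sub>F n in V. n \<in> S \<Longrightarrow> \<forall>\<^sub>F n in U. n \<in> R"
    and f: "(f \<longlongrightarrow> 0) V"
  shows "(g \<longlongrightarrow> 0) U"
proof (rule ccontr)
  assume "\<not> (g \<longlongrightarrow> 0) U"
  then obtain e where e: "0 < e" "\<not> (\<forall>\<^sub>F n in U. \<bar>g n\<bar> < e)"
    unfolding tendsto_iff dist_real_def by auto
  then have Y: "\<forall>\<^sub>F n in U. \<not> \<bar>g n\<bar> < e" using nonprincipal_not[OF U, of "\<lambda>n. \<bar>g n\<bar> < e"] by simp
  \<comment> \<open>Convergence along V is encoded by countably many sets of V; their partners all
    lie in U.\<close>
  define S where "S j = {n. \<bar>f n\<bar> < inverse (real (Suc j))}" for j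
  have "\<forall>j. \<exists>R. E (S j) R" using mod_fin_iso_total[OF E] by blast
  then obtain R where R: "\<And>j. E (S j) (R j)" by metis
  have "\<forall>\<^sub>F n in V. n \<in> S j" for j
    using tendstoD[OF f, of "inverse (real (Suc j))"] by (simp add: S_def)
  then have RU: "\<forall>\<^sub>F n in U. n \<in> R j" for j using VU[OF R] by blast
  \<comment> \<open>The finitely many conditions up to j hold together on a set of U, which is
    infinite and so has members beyond j.\<close>
  have "\<exists>n\<ge>j. \<not> \<bar>g n\<bar> < e \<and> (\<forall>i\<in>{..j}. n \<in> R i)" for j
  proof -
    have "\<forall>\<^sub>F n in U. \<forall>i\<in>{..j}. n \<in> R i" using RU by (intro eventually_ball_finite) auto
    with Y have "\<forall>\<^sub>F n in U. n \<in> {n. \<not> \<bar>g n\<bar> < e \<and> (\<forall>i\<in>{..j}. n \<in> R i)}"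
      by eventually_elim simp
    from nonprincipal_infinite[OF U this] show ?thesis
      unfolding infinite_nat_iff_unbounded_le by blast
  qed
  then obtain x where x: "\<And>j. j \<le> x j" "\<And>j. \<not> \<bar>g (x j)\<bar> < e" "\<And>i j. i \<le> j \<Longrightarrow> x j \<in> R i"
    unfolding Ball_def atMost_iff by metis
  have inf: "infinite (range x)" unfolding infinite_nat_iff_unbounded_le using x(1) by blast
  \<comment> \<open>The range of x is a pseudo-intersection of the sets R j, so T is almost
    contained in every S j and f tends to zero along T. The transported convergence of g along the
    range of x contradicts the choice of x.\<close>
  obtain T where T: "E T (range x)" using mod_fin_iso_onto[OF E] by blast
  have "(f \<longlongrightarrow> 0) (inf sequentially (principal T))"
    unfolding tendsto_iff eventually_inf_principal
  proof (intro allI impI)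
    fix d :: real assume "0 < d"
    then obtain j where j: "inverse (real (Suc j)) < d" using reals_Archimedean by blast
    \<comment> \<open>Only the first j terms of x can fall outside R j.\<close>
    have "i < j" if "x i \<notin> R j" for i using x(3)[of j i] that by (cases "j \<le> i") auto
    then have "range x - R j \<subseteq> x ` {..<j}" by auto
    then have "finite (range x - R j)" by (rule finite_subset) simp
    then have "finite (T - S j)" using mod_fin_iso_diff[OF E T R] by simp
    then have "\<forall>\<^sub>F n in sequentially. n \<notin> T - S j"
      by (simp add: cofinite_eq_sequentially[symmetric] eventually_cofinite set_diff_eq)
    then show "\<forall>\<^sub>F n in sequentially. n \<in> T \<longrightarrow> dist (f n) 0 < d"
      by eventually_elim (use j in \<open>auto simp: S_def\<close>)
  qed
  from fg[OF T this] have "\<forall>\<^sub>F n in sequentially. n \<in> range x \<longrightarrow> \<bar>g n\<bar> < e"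
    using e(1) unfolding tendsto_iff eventually_inf_principal by simp
  then have "\<forall>\<^sub>F n in sequentially. n \<notin> range x" by eventually_elim (use x(2) in auto)
  with inf show False
    by (simp add: cofinite_eq_sequentially[symmetric] eventually_cofinite)
qed

section \<open>Ring isomorphisms\<close>

locale MHS_iso =
  fixes k l :: "nat \<Rightarrow> nat" and \<phi>
  assumes k: "\<forall>n. 0 < k n" and l: "\<forall>n. 0 < l n" and iso: "\<phi> \<in> ring_iso (MHS k) (MHS l)"
begin

text \<open>A relation and not a function, since the image of a projection class determines R only
  up to finite sets. \<open>lifts\<close> treats representatives of general elements in the same
  way.\<close>

definition corr :: "nat set \<Rightarrow> nat set \<Rightarrow> bool" where
  "corr S R \<longleftrightarrow> \<phi> (seq_class k sequentially (proj_seq k S)) = seq_class l sequentially (proj_seq l R)"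

definition lifts :: "(nat \<Rightarrow> complex mat) \<Rightarrow> (nat \<Rightarrow> complex mat) \<Rightarrow> bool" where
  "lifts a b \<longleftrightarrow> a \<in> carrier (bounded_seqs k) \<and> b \<in> carrier (bounded_seqs l) \<and>
     \<phi> (seq_class k sequentially a) = seq_class l sequentially b"

lemma \<phi>_inj: "A \<in> carrier (MHS k) \<Longrightarrow> B \<in> carrier (MHS k) \<Longrightarrow> \<phi> A = \<phi> B \<longleftrightarrow> A = B"
  using ring_iso_memE(5)[OF iso] by (auto simp: bij_betw_def inj_on_def)

lemma lifts_total: "a \<in> carrier (bounded_seqs k) \<Longrightarrow> \<exists>b. lifts a b"
  using ring_iso_memE(1)[OF iso seq_class_in_MHS[of a k]]
  unfolding MHS_eq_metric_ultraproduct seq_class_carrier lifts_def by blast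

lemma lifts_onto:
  assumes b: "b \<in> carrier (bounded_seqs l)"
  shows "\<exists>a. lifts a b"
proof -
  have "seq_class l sequentially b \<in> \<phi> ` carrier (MHS k)"
    using seq_class_in_MHS[OF b] ring_iso_memE(5)[OF iso] by (simp add: bij_betw_def)
  then obtain A where "A \<in> carrier (MHS k)" "\<phi> A = seq_class l sequentially b" by auto
  then show ?thesis using b
    unfolding MHS_eq_metric_ultraproduct seq_class_carrier lifts_def by blast
qed

lemma corr_lifts: "corr S R \<longleftrightarrow> lifts (proj_seq k S) (proj_seq l R)"
  by (simp add: corr_def lifts_def proj_seq_carrier)

lemma lifts_mult:
  assumes "lifts a b" "lifts a' b'"
  shows "lifts (\<lambda>n. a n * a' n) (\<lambda>n. b n * b' n)"
proof -
  have c: "a \<in> carrier (bounded_seqs k)" "a' \<in> carrier (bounded_seqs k)"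
    "b \<in> carrier (bounded_seqs l)" "b' \<in> carrier (bounded_seqs l)" using assms by (auto simp: lifts_def)
  have "\<phi> (seq_class k sequentially (\<lambda>n. a n * a' n)) = seq_class l sequentially (\<lambda>n. b n * b' n)"
    using ring_iso_memE(2)[OF iso seq_class_in_MHS[OF c(1)] seq_class_in_MHS[OF c(2)]] assms
    unfolding MHS_eq_metric_ultraproduct seq_class_ops[OF c(1,2)] by (simp add: lifts_def seq_class_ops)
  then show ?thesis using c by (simp add: lifts_def bounded_seqs_mult)
qed

lemma lifts_add:
  assumes "lifts a b" "lifts a' b'"
  shows "lifts (\<lambda>n. a n + a' n) (\<lambda>n. b n + b' n)"
proof -
  have c: "a \<in> carrier (bounded_seqs k)" "a' \<in> carrier (bounded_seqs k)"
    "b \<in> carrier (bounded_seqs l)" "b' \<in> carrier (bounded_seqs l)" using assms by (auto simp: lifts_def)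
  have "\<phi> (seq_class k sequentially (\<lambda>n. a n + a' n)) = seq_class l sequentially (\<lambda>n. b n + b' n)"
    using ring_iso_memE(3)[OF iso seq_class_in_MHS[OF c(1)] seq_class_in_MHS[OF c(2)]] assms
    unfolding MHS_eq_metric_ultraproduct seq_class_ops[OF c(1,2)] by (simp add: lifts_def seq_class_ops)
  then show ?thesis using c by (simp add: lifts_def bounded_seqs_add)
qed

lemma lifts_one: "lifts (\<lambda>n. 1\<^sub>m (k n)) (\<lambda>n. 1\<^sub>m (l n))"
  using ring_iso_memE(4)[OF iso]
  by (simp add: lifts_def bounded_seqs_one MHS_eq_metric_ultraproduct seq_class_one)

lemma lifts_class_eq:
  assumes "lifts a b" "lifts a' b'"
  shows "seq_class k sequentially a = seq_class k sequentially a' \<longleftrightarrow> seq_class l sequentially b = seq_class l sequentially b'"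
  using assms \<phi>_inj[OF seq_class_in_MHS seq_class_in_MHS, of a a'] by (simp add: lifts_def)

lemma corr_Int: "corr S R \<Longrightarrow> corr S' R' \<Longrightarrow> corr (S \<inter> S') (R \<inter> R')"
proof -
  have eq: "(\<lambda>n. proj_seq m A n * proj_seq m B n) = proj_seq m (A \<inter> B)" for m A B
    by (rule ext) (simp add: proj_seq_mult proj_seq_mat, simp add: proj_seq_def)
  show "corr S R \<Longrightarrow> corr S' R' \<Longrightarrow> corr (S \<inter> S') (R \<inter> R')"
    unfolding corr_lifts using lifts_mult[of "proj_seq k S" "proj_seq l R" "proj_seq k S'" "proj_seq l R'"]
    by (simp only: eq)
qed

text \<open>Totality is the classification of central idempotents in \<open>MHS l\<close>, applied
  to images of projections; surjectivity is that in \<open>MHS k\<close>, applied to preimages. The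
  order is algebraic: S is almost contained in S' iff the product of their projections is the
  projection of S.\<close>

lemma mod_fin_iso_corr: "mod_fin_iso corr"
  unfolding mod_fin_iso_def
proof (intro conjI allI impI)
  fix S
  have "central_idempotent (MHS l) (\<phi> (seq_class k sequentially (proj_seq k S)))"
    by (rule central_idempotent_ring_iso[OF iso])
      (simp add: MHS_eq_metric_ultraproduct central_idempotent_proj_class)
  then show "\<exists>R. corr S R" using central_idempotent_MHS[OF l] unfolding corr_def by blast
next
  fix R
  obtain a where a: "lifts a (proj_seq l R)" using lifts_onto[OF proj_seq_carrier] by blast
  then have car: "seq_class k sequentially a \<in> carrier (MHS k)" by (simp add: lifts_def seq_class_in_MHS)
  have "inv_into (carrier (MHS k)) \<phi> \<in> ring_iso (MHS l) (MHS k)"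
    using iso by (intro ring_iso_set_sym) (simp_all add: MHS_eq_metric_ultraproduct ring_metric_ultraproduct)
  then have "central_idempotent (MHS k) (inv_into (carrier (MHS k)) \<phi> (seq_class l sequentially (proj_seq l R)))"
    by (rule central_idempotent_ring_iso) (simp add: MHS_eq_metric_ultraproduct central_idempotent_proj_class)
  moreover have "inv_into (carrier (MHS k)) \<phi> (seq_class l sequentially (proj_seq l R)) = seq_class k sequentially a"
    using a car ring_iso_memE(5)[OF iso] by (intro inv_into_f_eq) (simp_all add: lifts_def bij_betw_def)
  ultimately obtain S where "seq_class k sequentially a = seq_class k sequentially (proj_seq k S)"
    using central_idempotent_MHS[OF k] by metis
  then show "\<exists>S. corr S R" using a unfolding corr_def lifts_def by auto
next
  fix S R S' R' assume E: "corr S R" "corr S' R'"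
  \<comment> \<open>Equality of the projections of S and of its intersection with S' is finiteness
    of a symmetric difference, which is just S - S'.\<close>
  have s: "(A \<inter> B - A) \<union> (A - A \<inter> B) = A - B" for A B :: "nat set" by blast
  show "finite (S - S') \<longleftrightarrow> finite (R - R')"
    using lifts_class_eq[OF corr_Int[OF E, unfolded corr_lifts] E(1)[unfolded corr_lifts]]
    unfolding proj_class_eq_iff[of k, OF k] proj_class_eq_iff[of l, OF l] s .
qed

lemma eq_along_corr:
  assumes ab: "lifts a b" "lifts a' b'" and SR: "corr S R"
  shows "((\<lambda>n. hs_norm (a n - a' n)) \<longlongrightarrow> 0) (inf sequentially (principal S)) \<longleftrightarrow>
    ((\<lambda>n. hs_norm (b n - b' n)) \<longlongrightarrow> 0) (inf sequentially (principal R))"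
proof -
  have c: "a \<in> carrier (bounded_seqs k)" "a' \<in> carrier (bounded_seqs k)"
    "b \<in> carrier (bounded_seqs l)" "b' \<in> carrier (bounded_seqs l)" using ab by (auto simp: lifts_def)
  show ?thesis
    unfolding eq_along_iff_proj_mult[OF c(1,2)] eq_along_iff_proj_mult[OF c(3,4)]
      MHS_eq_metric_ultraproduct seq_class_ops[OF proj_seq_carrier c(1)] seq_class_ops[OF proj_seq_carrier c(2)]
      seq_class_ops[OF proj_seq_carrier c(3)] seq_class_ops[OF proj_seq_carrier c(4)]
    by (intro lifts_class_eq lifts_mult ab SR[unfolded corr_lifts])
qed

text \<open>Both existence and uniqueness of \<theta> rest on this: transport of equality pins down
  the Stone dual on every class, and it has to be the one given by \<open>corr\<close>.\<close>

lemma transports_equality_iff: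
  assumes \<theta>: "\<theta> \<in> boundary_homeos"
  shows "transports_equality k \<phi> \<theta> \<longleftrightarrow>
    (\<forall>S R. corr S R \<longrightarrow> stone_dual \<theta> (fin_equiv `` {S}) = fin_equiv `` {R})"
proof (intro iffI allI impI)
  fix S R assume tr: "transports_equality k \<phi> \<theta>" and SR: "corr S R"
  have "stone_dual \<theta> (fin_equiv `` {S}) \<in> P_mod_Fin"
    using theI'[OF stone_dual_ex1[OF \<theta> fin_equiv_class_in_P_mod_Fin[of S]]] unfolding stone_dual_def by blast
  then obtain T where T: "stone_dual \<theta> (fin_equiv `` {S}) = fin_equiv `` {T}"
    unfolding P_mod_Fin_def by (elim quotientE) simp
  \<comment> \<open>The test elements are preimages of the projection of X and of zero. Their images
    agree along a set iff X meets it finitely, so T and R are distinguished by no X; the complements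
    of T and R then show that they differ by a finite set.\<close>
  have X: "finite (X \<inter> T) \<longleftrightarrow> finite (X \<inter> R)" for X
  proof -
    obtain a a' where ab: "lifts a (proj_seq l X)" "lifts a' (proj_seq l {})"
      using lifts_onto[OF proj_seq_carrier] by metis
    then have c: "a \<in> carrier (bounded_seqs k)" "a' \<in> carrier (bounded_seqs k)"
      and im: "\<phi> (seq_class k sequentially a) = seq_class l sequentially (proj_seq l X)"
        "\<phi> (seq_class k sequentially a') = seq_class l sequentially (proj_seq l {})"
      by (simp_all add: lifts_def)
    have "eq_on (fin_equiv `` {S}) (seq_class k sequentially a) (seq_class k sequentially a') \<longleftrightarrow>
        eq_on (stone_dual \<theta> (fin_equiv `` {S})) (\<phi> (seq_class k sequentially a)) (\<phi> (seq_class k sequentially a'))"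
      using tr seq_class_in_MHS[OF c(1)] seq_class_in_MHS[OF c(2)] fin_equiv_class_in_P_mod_Fin
      unfolding transports_equality_def by blast
    then have "finite (X \<inter> R) \<longleftrightarrow> finite (X \<inter> T)"
      unfolding T im eq_on_class_iff[OF c] eq_on_class_iff[OF proj_seq_carrier proj_seq_carrier]
        eq_along_corr[OF ab SR] proj_eq_along_iff[OF l] .
    then show ?thesis by (rule sym)
  qed
  have "finite (- T \<inter> R)" "finite (- R \<inter> T)" using X[of "- T"] X[of "- R"] by simp_all
  then have "(T, R) \<in> fin_equiv" by (simp add: fin_equiv_def Diff_eq Int_commute)
  then show "stone_dual \<theta> (fin_equiv `` {S}) = fin_equiv `` {R}"
    unfolding T by (rule equiv_class_eq[OF equiv_fin_equiv])
next
  assume R: "\<forall>S R. corr S R \<longrightarrow> stone_dual \<theta> (fin_equiv `` {S}) = fin_equiv `` {R}"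
  show "transports_equality k \<phi> \<theta>"
    unfolding transports_equality_def
  proof (intro ballI)
    fix A B s assume "A \<in> carrier (MHS k)" "B \<in> carrier (MHS k)" "s \<in> P_mod_Fin"
    then obtain a a' S where ca: "a \<in> carrier (bounded_seqs k)" "a' \<in> carrier (bounded_seqs k)"
      and A: "A = seq_class k sequentially a" "B = seq_class k sequentially a'" and s: "s = fin_equiv `` {S}"
      unfolding MHS_eq_metric_ultraproduct seq_class_carrier P_mod_Fin_def by (elim bexE quotientE)
    obtain b b' where ab: "lifts a b" "lifts a' b'" using lifts_total ca by metis
    then have c: "b \<in> carrier (bounded_seqs l)" "b' \<in> carrier (bounded_seqs l)"
      and im: "\<phi> (seq_class k sequentially a) = seq_class l sequentially b"
        "\<phi> (seq_class k sequentially a') = seq_class l sequentially b'"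
      by (simp_all add: lifts_def)
    obtain Q where Q: "corr S Q" using mod_fin_iso_total[OF mod_fin_iso_corr] by blast
    have sd: "stone_dual \<theta> (fin_equiv `` {S}) = fin_equiv `` {Q}" using R Q by blast
    show "eq_on s A B \<longleftrightarrow> eq_on (stone_dual \<theta> s) (\<phi> A) (\<phi> B)"
      unfolding A s sd im eq_on_class_iff[OF ca] eq_on_class_iff[OF c] by (rule eq_along_corr[OF ab Q])
  qed
qed

lemma ex1_transports_equality: "\<exists>!\<theta>. \<theta> \<in> boundary_homeos \<and> transports_equality k \<phi> \<theta>"
proof (rule ex1I[of _ "restrict (dual_filter corr) nonprincipal_ultrafilters"])
  note E = mod_fin_iso_corr
  show "restrict (dual_filter corr) nonprincipal_ultrafilters \<in> boundary_homeos \<and>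
      transports_equality k \<phi> (restrict (dual_filter corr) nonprincipal_ultrafilters)"
    using dual_filter_homeo[OF E] dual_filter_iff[OF E]
    by (auto simp: transports_equality_iff intro!: stone_dual_eqI)
next
  note E = mod_fin_iso_corr
  fix \<theta> assume a: "\<theta> \<in> boundary_homeos \<and> transports_equality k \<phi> \<theta>"
  then have \<theta>: "\<theta> \<in> boundary_homeos"
    and sd: "\<And>S R. corr S R \<Longrightarrow> stone_dual \<theta> (fin_equiv `` {S}) = fin_equiv `` {R}"
    using transports_equality_iff by blast+
  show "\<theta> = restrict (dual_filter corr) nonprincipal_ultrafilters"
  proof (rule extensionalityI)
    show "\<theta> \<in> extensional nonprincipal_ultrafilters" using \<theta> by (simp add: boundary_homeos_def)
    fix U assume U: "U \<in> nonprincipal_ultrafilters"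
    \<comment> \<open>A point of the boundary is determined by its sets, and each set has a partner
      on which both maps are read off from U.\<close>
    have "eventually P (\<theta> U) \<longleftrightarrow> eventually P (dual_filter corr U)" for P
    proof -
      obtain R where R: "corr {n. P n} R" using mod_fin_iso_total[OF E] by blast
      show ?thesis using stone_dual_eventually[OF \<theta> sd[OF R] U] dual_filter_iff[OF E U R] by simp
    qed
    then show "\<theta> U = restrict (dual_filter corr) nonprincipal_ultrafilters U"
      using U by (simp add: filter_eq_iff)
  qed simp
qed

section \<open>Induced isomorphisms of metric ultraproducts\<close>

lemma seq_class_eq_transfer:
  assumes U: "U \<in> nonprincipal_ultrafilters"
    and VU: "\<And>S R. corr S R \<Longrightarrow> (\<forall>\<^sub>F n in V. n \<in> S) \<longleftrightarrow> (\<forall>\<^sub>F n in U. n \<in> R)"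
    and V: "V \<in> nonprincipal_ultrafilters"
    and ab: "lifts a b" "lifts a' b'"
  shows "seq_class k V a = seq_class k V a' \<longleftrightarrow> seq_class l U b = seq_class l U b'"
proof -
  note E = mod_fin_iso_corr
  have c: "a \<in> carrier (bounded_seqs k)" "a' \<in> carrier (bounded_seqs k)"
    "b \<in> carrier (bounded_seqs l)" "b' \<in> carrier (bounded_seqs l)" using ab by (auto simp: lifts_def)
  let ?f = "\<lambda>n. hs_norm (a n - a' n)" and ?g = "\<lambda>n. hs_norm (b n - b' n)"
  have "(?g \<longlongrightarrow> 0) U" if "(?f \<longlongrightarrow> 0) V"
    by (rule tendsto_transfer[OF E _ U _ that]) (use eq_along_corr[OF ab] VU in auto)
  \<comment> \<open>The converse relation exchanges the roles of the two sides, so the same transfer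
    argument gives the other implication.\<close>
  moreover have "(?f \<longlongrightarrow> 0) V" if "(?g \<longlongrightarrow> 0) U"
    by (rule tendsto_transfer[OF mod_fin_iso_conversep[OF E] _ V _ that]) (use eq_along_corr[OF ab] VU in auto)
  ultimately show ?thesis unfolding seq_class_eq_iff[OF c(1,2)] seq_class_eq_iff[OF c(3,4)] by blast
qed

text \<open>The two directions of \<open>eq\<close> say that the induced map is well defined and
  that it is injective. Operations, unit and surjectivity are inherited from \<open>\<phi>\<close>
  through lifts of representatives.\<close>

lemma ex_induced_ring_iso:
  assumes eq: "\<And>a b a' b'. lifts a b \<Longrightarrow> lifts a' b' \<Longrightarrow>
    seq_class k V a = seq_class k V a' \<longleftrightarrow> seq_class l U b = seq_class l U b'"
  shows "\<exists>\<psi>\<in>ring_iso (metric_ultraproduct k V) (metric_ultraproduct l U). induces k V l U \<phi> \<psi>"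
proof -
  \<comment> \<open>Any lift of any representative may be chosen; by \<open>eq\<close> the resulting
    class is the same.\<close>
  define \<psi> where "\<psi> A = (SOME B. \<exists>a b. lifts a b \<and> A = seq_class k V a \<and> B = seq_class l U b)" for A
  have \<psi>: "\<psi> (seq_class k V a) = seq_class l U b" if "lifts a b" for a b
    unfolding \<psi>_def by (rule some_equality) (use that eq in blast)+
  have liftsD: "a \<in> carrier (bounded_seqs k)" "b \<in> carrier (bounded_seqs l)" if "lifts a b" for a b
    using that by (auto simp: lifts_def)
  have rep: "\<exists>a b. lifts a b \<and> A = seq_class k V a" if "A \<in> carrier (metric_ultraproduct k V)" for A
    using that lifts_total unfolding seq_class_carrier by blast
  have "\<psi> \<in> ring_iso (metric_ultraproduct k V) (metric_ultraproduct l U)"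
  proof (rule ring_iso_memI)
    fix A assume "A \<in> carrier (metric_ultraproduct k V)"
    then obtain a b where a: "lifts a b" "A = seq_class k V a" using rep by blast
    then show "\<psi> A \<in> carrier (metric_ultraproduct l U)"
      using \<psi>[OF a(1)] liftsD(2)[OF a(1)] unfolding seq_class_carrier by blast
    fix A' assume "A' \<in> carrier (metric_ultraproduct k V)"
    then obtain a' b' where a': "lifts a' b'" "A' = seq_class k V a'" using rep by blast
    show "\<psi> (A \<otimes>\<^bsub>metric_ultraproduct k V\<^esub> A') = \<psi> A \<otimes>\<^bsub>metric_ultraproduct l U\<^esub> \<psi> A'"
      unfolding a(2) a'(2) seq_class_ops[OF liftsD(1)[OF a(1)] liftsD(1)[OF a'(1)]]
        \<psi>[OF a(1)] \<psi>[OF a'(1)] \<psi>[OF lifts_mult[OF a(1) a'(1)]]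
        seq_class_ops[OF liftsD(2)[OF a(1)] liftsD(2)[OF a'(1)]] ..
    show "\<psi> (A \<oplus>\<^bsub>metric_ultraproduct k V\<^esub> A') = \<psi> A \<oplus>\<^bsub>metric_ultraproduct l U\<^esub> \<psi> A'"
      unfolding a(2) a'(2) seq_class_ops[OF liftsD(1)[OF a(1)] liftsD(1)[OF a'(1)]]
        \<psi>[OF a(1)] \<psi>[OF a'(1)] \<psi>[OF lifts_add[OF a(1) a'(1)]]
        seq_class_ops[OF liftsD(2)[OF a(1)] liftsD(2)[OF a'(1)]] ..
  next
    show "\<psi> \<one>\<^bsub>metric_ultraproduct k V\<^esub> = \<one>\<^bsub>metric_ultraproduct l U\<^esub>"
      unfolding seq_class_one by (rule \<psi>[OF lifts_one])
  next
    show "bij_betw \<psi> (carrier (metric_ultraproduct k V)) (carrier (metric_ultraproduct l U))"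
      unfolding bij_betw_def
    proof (rule conjI[OF inj_onI equalityI[OF subsetI subsetI]])
      fix A A' assume "A \<in> carrier (metric_ultraproduct k V)" "A' \<in> carrier (metric_ultraproduct k V)"
        and e: "\<psi> A = \<psi> A'"
      then obtain a b a' b' where a: "lifts a b" "A = seq_class k V a" "lifts a' b'" "A' = seq_class k V a'"
        using rep by meson
      show "A = A'" using e unfolding a(2,4) \<psi>[OF a(1)] \<psi>[OF a(3)] eq[OF a(1,3)] .
    next
      fix B assume "B \<in> \<psi> ` carrier (metric_ultraproduct k V)"
      then obtain A where A: "A \<in> carrier (metric_ultraproduct k V)" "B = \<psi> A" by blast
      obtain a b where a: "lifts a b" "A = seq_class k V a" using rep[OF A(1)] by blast
      show "B \<in> carrier (metric_ultraproduct l U)"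
        unfolding A(2) a(2) \<psi>[OF a(1)] seq_class_carrier using liftsD(2)[OF a(1)] by blast
    next
      fix B assume "B \<in> carrier (metric_ultraproduct l U)"
      then obtain b where b: "b \<in> carrier (bounded_seqs l)" "B = seq_class l U b"
        unfolding seq_class_carrier by blast
      obtain a where a: "lifts a b" using lifts_onto[OF b(1)] by blast
      have "seq_class k V a \<in> carrier (metric_ultraproduct k V)"
        unfolding seq_class_carrier using liftsD(1)[OF a] by blast
      then show "B \<in> \<psi> ` carrier (metric_ultraproduct k V)" using \<psi>[OF a] b(2) by (metis imageI)
    qed
  qed
  moreover have "induces k V l U \<phi> \<psi>"
    unfolding induces_def using \<psi> by (simp add: lifts_def)
  ultimately show ?thesis by blast
qed

end

theorem theorem5p7:
  fixes k l :: "nat \<Rightarrow> nat"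
    and \<phi> :: "(nat \<Rightarrow> complex mat) set \<Rightarrow> (nat \<Rightarrow> complex mat) set"
  assumes "\<forall>n. k n > 0" and "\<forall>n. l n > 0"
    and "filterlim k at_top sequentially" and "filterlim l at_top sequentially"
    and "\<phi> \<in> ring_iso (MHS k) (MHS l)"
  shows "(\<exists>!\<theta>. \<theta> \<in> boundary_homeos \<and> transports_equality k \<phi> \<theta>) \<and>
    (\<forall>\<theta>. \<theta> \<in> boundary_homeos \<and> transports_equality k \<phi> \<theta> \<longrightarrow>
      (\<forall>U\<in>nonprincipal_ultrafilters.
        \<exists>\<psi>\<in>ring_iso (metric_ultraproduct k (\<theta> U)) (metric_ultraproduct l U).
          induces k (\<theta> U) l U \<phi> \<psi>))"
proof (intro conjI allI impI ballI)
  interpret MHS_iso k l \<phi> using assms by unfold_locales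
  show "\<exists>!\<theta>. \<theta> \<in> boundary_homeos \<and> transports_equality k \<phi> \<theta>" by (rule ex1_transports_equality)
  fix \<theta> U assume a: "\<theta> \<in> boundary_homeos \<and> transports_equality k \<phi> \<theta>"
    and U: "U \<in> nonprincipal_ultrafilters"
  \<comment> \<open>Any such \<theta> has the Stone dual given by \<open>corr\<close>, so membership
    in \<theta>(U) and in U correspond under \<open>corr\<close>, as the transfer to ultraproducts
    requires.\<close>
  then have \<theta>: "\<theta> \<in> boundary_homeos"
    and sd: "\<And>S R. corr S R \<Longrightarrow> stone_dual \<theta> (fin_equiv `` {S}) = fin_equiv `` {R}"
    using transports_equality_iff by blast+
  show "\<exists>\<psi>\<in>ring_iso (metric_ultraproduct k (\<theta> U)) (metric_ultraproduct l U). induces k (\<theta> U) l U \<phi> \<psi>"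
    by (rule ex_induced_ring_iso)
      (rule seq_class_eq_transfer[OF U stone_dual_eventually[OF \<theta> sd U]
          boundary_homeos_nonprincipal[OF \<theta> U]])
qed

end
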